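(* Let $r\in\mathbb N\cup\{\infty\}$ and $M$ be a $C^r$-regular $C^r$-manifold modelled on a real locally convex space $E$. Then there exists a $C^r$-embedding $\theta\colon M\to(E\times\mathbb R)^M$.
   Context: Conventions: everything is over $\mathbb R$; $\mathbb N=\{1,2,\ldots\}$; all topological spaces and topological vector spaces are Hausdorff. For open subsets of locally convex spaces, $C^r$ means: continuous, with iterated directional derivatives $d^{k}f(x;y_1,\ldots,y_k)$ existing for all $k\le r$ and continuous in $(x,y_1,\ldots,y_k)$. A $C^r$-manifold modelled on a locally convex space $E$ is a Hausdorff space with a maximal atlas of charts $\phi\colon U_\phi\to V_\phi$ (homeomorphisms from open subsets of the manifold onto open subsets of $E$) with $C^r$ transition maps. A $C^r$-manifold $M$ is $C^r$-regular if the topology on $M$ is initial with respect to the set $C^r(M,\mathbb R)$ of all real-valued $C^r$-functions on $M$. $(E\times\mathbb R)^M$ denotes the locally convex direct product, with the product topology, of copies of $E\times\mathbb R$ indexed by the points of $M$. A $C^r$-map $f\colon M\to N$ between $C^r$-manifolds modelled on $E_1$, $E_2$ is a $C^r$-immersion if for each $x\in M$ there are charts $\phi\colon U_\phi\to V_\phi\subseteq E_1$ of $M$ around $x$ and $\psi\colon U_\psi\to V_\psi\subseteq E_2$ of $N$ around $f(x)$ such that $f(U_\phi)\subseteq U_\psi$ and $\psi\circ f\circ\phi^{-1}=j|_{V_\phi}$ for a linear map $j\colon E_1\to E_2$ which is a topological embedding (homeomorphism onto its image) onto a complemented vector subspace of $E_2$ (a subspace $F\subseteq E_2$ is complemented if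 there is a vector subspace $C\subseteq E_2$ such that addition $F\times C\to E_2$ is an isomorphism of topological vector spaces). $f$ is a $C^r$-embedding if it is both a $C^r$-immersion and a topological embedding. *)

theory Defs
  imports "HOL-Analysis.Analysis" "HOL-Library.Function_Algebras"
begin

section \<open>Pointwise real vector space structure on functions\<close>

instantiation "fun" :: (type, real_vector) real_vector
begin

definition scaleR_fun :: "real \<Rightarrow> ('a \<Rightarrow> 'b) \<Rightarrow> 'a \<Rightarrow> 'b"
  where "scaleR_fun c f = (\<lambda>x. c *\<^sub>R f x)"

instance
  by standard (auto simp: scaleR_fun_def fun_eq_iff algebra_simps)

end

section \<open>Locally convex spaces\<close>

text \<open>A locally convex space is given by its topology; the underlying vector space
  is the topological carrier, a linear subspace of the ambient type.
  This makes powers with an arbitrary, possibly empty, index set available.\<close>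

definition lc_space :: "'a::real_vector topology \<Rightarrow> bool" where
  "lc_space E \<longleftrightarrow>
     subspace (topspace E) \<and>
     Hausdorff_space E \<and>
     continuous_map (prod_topology E E) E (\<lambda>(x, y). x + y) \<and>
     continuous_map (prod_topology euclideanreal E) E (\<lambda>(c, x). c *\<^sub>R x) \<and>
     (\<forall>U. openin E U \<and> 0 \<in> U \<longrightarrow> (\<exists>V. openin E V \<and> 0 \<in> V \<and> convex V \<and> V \<subseteq> U))"

text \<open>The direct power of \<open>E\<close> with index set \<open>I\<close>. Families indexed by \<open>I\<close> are represented as
  functions vanishing off \<open>I\<close> (rather than as extensional functions), so that the vector
  space operations are those of the function type.\<close>

definition lc_power :: "'a::real_vector topology \<Rightarrow> 'i set \<Rightarrow> ('i \<Rightarrow> 'a) topology" where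
  "lc_power E I = subtopology (product_topology (\<lambda>_. E) UNIV) {f. \<forall>i. i \<notin> I \<longrightarrow> f i = 0}"

lemma homeomorphic_map_lc_power:
  assumes "0 \<in> topspace E"
  shows "homeomorphic_map (lc_power E I) (product_topology (\<lambda>_. E) I) (\<lambda>f. restrict f I)"
proof -
  let ?g = "\<lambda>f i. if i \<in> I then f i else 0"
  have 1: "continuous_map (lc_power E I) (product_topology (\<lambda>_. E) I) (\<lambda>f. restrict f I)"
    unfolding lc_power_def
    by (auto simp: continuous_map_componentwise
        intro!: continuous_map_from_subtopology continuous_map_product_projection)
  have 2: "continuous_map (product_topology (\<lambda>_. E) I) (lc_power E I) ?g"
    unfolding lc_power_def continuous_map_in_subtopology continuous_map_componentwise_UNIV
  proof (intro conjI allI)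
    fix i
    show "continuous_map (product_topology (\<lambda>_. E) I) E (\<lambda>f. ?g f i)"
      using assms by (cases "i \<in> I") (auto intro: continuous_map_product_projection)
  qed auto
  have "homeomorphic_maps (lc_power E I) (product_topology (\<lambda>_. E) I) (\<lambda>f. restrict f I) ?g"
    unfolding homeomorphic_maps_def
    using 1 2 by (auto simp: lc_power_def fun_eq_iff PiE_def extensional_def)
  then show ?thesis
    by (rule homeomorphic_maps_imp_map)
qed

definition linear_between :: "'a::real_vector topology \<Rightarrow> 'b::real_vector topology \<Rightarrow> ('a \<Rightarrow> 'b) \<Rightarrow> bool" where
  "linear_between E F j \<longleftrightarrow>
     j ` topspace E \<subseteq> topspace F \<and>
     (\<forall>x\<in>topspace E. \<forall>y\<in>topspace E. j (x + y) = j x + j y) \<and>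
     (\<forall>c. \<forall>x\<in>topspace E. j (c *\<^sub>R x) = c *\<^sub>R j x)"

definition complemented_subspace :: "'a::real_vector topology \<Rightarrow> 'a set \<Rightarrow> bool" where
  "complemented_subspace E F \<longleftrightarrow>
     subspace F \<and> F \<subseteq> topspace E \<and>
     (\<exists>C. subspace C \<and> C \<subseteq> topspace E \<and>
        homeomorphic_map (prod_topology (subtopology E F) (subtopology E C)) E (\<lambda>(x, y). x + y))"

section \<open>Differentiable maps between locally convex spaces\<close>

definition has_dir_deriv ::
  "'b::real_vector topology \<Rightarrow> ('a::real_vector \<Rightarrow> 'b) \<Rightarrow> 'a \<Rightarrow> 'a \<Rightarrow> 'b \<Rightarrow> bool" where
  "has_dir_deriv F f x y l \<longleftrightarrow>
     limitin F (\<lambda>t::real. (1 / t) *\<^sub>R (f (x + t *\<^sub>R y) - f x)) l (at 0)"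

definition dir_deriv ::
  "'b::real_vector topology \<Rightarrow> ('a::real_vector \<Rightarrow> 'b) \<Rightarrow> 'a \<Rightarrow> 'a \<Rightarrow> 'b" where
  "dir_deriv F f x y = (THE l. has_dir_deriv F f x y l)"

text \<open>\<open>iter_deriv F f [y\<^sub>1, \<dots>, y\<^sub>k] x\<close> is $d^k f(x; y_1, \ldots, y_k)$; the derivative
  in direction $y_1$ is taken first.\<close>

fun iter_deriv ::
  "'b::real_vector topology \<Rightarrow> ('a::real_vector \<Rightarrow> 'b) \<Rightarrow> 'a list \<Rightarrow> 'a \<Rightarrow> 'b" where
  "iter_deriv F f [] x = f x"
| "iter_deriv F f (y # ys) x = iter_deriv F (\<lambda>z. dir_deriv F f z y) ys x"

text \<open>The case \<open>k = 0\<close> of the last conjunct is continuity of \<open>f : U \<rightarrow> F\<close>.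
  Values of \<open>f\<close> outside \<open>U\<close> are irrelevant.\<close>

definition Cr_on ::
  "enat \<Rightarrow> 'a::real_vector topology \<Rightarrow> 'b::real_vector topology \<Rightarrow> 'a set \<Rightarrow> ('a \<Rightarrow> 'b) \<Rightarrow> bool" where
  "Cr_on r E F U f \<longleftrightarrow>
     openin E U \<and>
     (\<forall>x\<in>U. \<forall>ys\<in>lists (topspace E). \<forall>y\<in>topspace E. enat (Suc (length ys)) \<le> r \<longrightarrow>
        (\<exists>l. has_dir_deriv F (iter_deriv F f ys) x y l)) \<and>
     (\<forall>k. enat k \<le> r \<longrightarrow>
        continuous_map (prod_topology (subtopology E U) (product_topology (\<lambda>_. E) {..<k})) F
          (\<lambda>(x, y). iter_deriv F f (map y [0..<k]) x))"

section \<open>Manifolds modelled on locally convex spaces\<close>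

text \<open>A chart $\phi\colon U \to V$ is represented by the pair \<open>(U, \<phi>)\<close>, with \<open>V = \<phi> ` U\<close>; the values
  of \<open>\<phi>\<close> outside \<open>U\<close> are irrelevant.\<close>

type_synonym ('m, 'e) chart = "'m set \<times> ('m \<Rightarrow> 'e)"

definition is_chart :: "'m topology \<Rightarrow> 'e::real_vector topology \<Rightarrow> ('m, 'e) chart \<Rightarrow> bool" where
  "is_chart X E = (\<lambda>(U, \<phi>).
     openin X U \<and> openin E (\<phi> ` U) \<and>
     homeomorphic_map (subtopology X U) (subtopology E (\<phi> ` U)) \<phi>)"

definition Cr_transition :: "enat \<Rightarrow> 'e::real_vector topology \<Rightarrow> ('m, 'e) chart \<Rightarrow> ('m, 'e) chart \<Rightarrow> bool" where
  "Cr_transition r E = (\<lambda>(U, \<phi>) (V, \<psi>). Cr_on r E E (\<phi> ` (U \<inter> V)) (\<psi> \<circ> inv_into U \<phi>))"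

definition Cr_atlas :: "enat \<Rightarrow> 'm topology \<Rightarrow> 'e::real_vector topology \<Rightarrow> ('m, 'e) chart set \<Rightarrow> bool" where
  "Cr_atlas r X E A \<longleftrightarrow>
     (\<forall>c\<in>A. is_chart X E c) \<and>
     \<Union> (fst ` A) = topspace X \<and>
     (\<forall>c\<in>A. \<forall>d\<in>A. Cr_transition r E c d)"

definition maximal_Cr_atlas :: "enat \<Rightarrow> 'm topology \<Rightarrow> 'e::real_vector topology \<Rightarrow> ('m, 'e) chart set \<Rightarrow> bool" where
  "maximal_Cr_atlas r X E A \<longleftrightarrow>
     Cr_atlas r X E A \<and> (\<forall>B. Cr_atlas r X E B \<and> A \<subseteq> B \<longrightarrow> B = A)"

definition Cr_manifold :: "enat \<Rightarrow> 'm topology \<Rightarrow> 'e::real_vector topology \<Rightarrow> ('m, 'e) chart set \<Rightarrow> bool" where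
  "Cr_manifold r X E A \<longleftrightarrow> lc_space E \<and> Hausdorff_space X \<and> maximal_Cr_atlas r X E A"

text \<open>The standard manifold structure of a locally convex space \<open>E\<close>: the maximal atlas
  containing the identity chart.\<close>

definition lc_atlas :: "enat \<Rightarrow> 'e::real_vector topology \<Rightarrow> ('e, 'e) chart set" where
  "lc_atlas r E = {c. is_chart E E c \<and>
     Cr_transition r E (topspace E, \<lambda>x. x) c \<and> Cr_transition r E c (topspace E, \<lambda>x. x)}"

definition Cr_map ::
  "enat \<Rightarrow> 'm topology \<Rightarrow> 'e::real_vector topology \<Rightarrow> ('m, 'e) chart set \<Rightarrow>
   'n topology \<Rightarrow> 'f::real_vector topology \<Rightarrow> ('n, 'f) chart set \<Rightarrow> ('m \<Rightarrow> 'n) \<Rightarrow> bool" where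
  "Cr_map r X E A Y F B f \<longleftrightarrow>
     continuous_map X Y f \<and>
     (\<forall>(U, \<phi>)\<in>A. \<forall>(V, \<psi>)\<in>B. Cr_on r E F (\<phi> ` (U \<inter> f -` V)) (\<psi> \<circ> f \<circ> inv_into U \<phi>))"

text \<open>Regularity: the sets $f^{-1}(W)$, with $f \in C^r(M, \real)$ and $W$ open,
  form a subbasis of the topology.\<close>

definition Cr_regular :: "enat \<Rightarrow> 'm topology \<Rightarrow> 'e::real_vector topology \<Rightarrow> ('m, 'e) chart set \<Rightarrow> bool" where
  "Cr_regular r X E A \<longleftrightarrow>
     X = topology_generated_by
       {f -` W \<inter> topspace X | f W.
          Cr_map r X E A euclideanreal euclideanreal (lc_atlas r euclideanreal) f \<and> open W}"

definition Cr_immersion ::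
  "enat \<Rightarrow> 'm topology \<Rightarrow> 'e::real_vector topology \<Rightarrow> ('m, 'e) chart set \<Rightarrow>
   'n topology \<Rightarrow> 'f::real_vector topology \<Rightarrow> ('n, 'f) chart set \<Rightarrow> ('m \<Rightarrow> 'n) \<Rightarrow> bool" where
  "Cr_immersion r X E A Y F B f \<longleftrightarrow>
     Cr_map r X E A Y F B f \<and>
     (\<forall>x\<in>topspace X. \<exists>(U, \<phi>)\<in>A. \<exists>(V, \<psi>)\<in>B.
        x \<in> U \<and> f x \<in> V \<and> f ` U \<subseteq> V \<and>
        (\<exists>j. linear_between E F j \<and> embedding_map E F j \<and>
             complemented_subspace F (j ` topspace E) \<and>
             (\<forall>v\<in>\<phi> ` U. (\<psi> \<circ> f \<circ> inv_into U \<phi>) v = j v)))"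

definition Cr_embedding ::
  "enat \<Rightarrow> 'm topology \<Rightarrow> 'e::real_vector topology \<Rightarrow> ('m, 'e) chart set \<Rightarrow>
   'n topology \<Rightarrow> 'f::real_vector topology \<Rightarrow> ('n, 'f) chart set \<Rightarrow> ('m \<Rightarrow> 'n) \<Rightarrow> bool" where
  "Cr_embedding r X E A Y F B f \<longleftrightarrow> Cr_immersion r X E A Y F B f \<and> embedding_map X Y f"

end

(*
  Each x in M has a C^r function h_x that is 1 on a neighbourhood N_x of x and vanishes off a closed
  subset of the domain of a chart phi_x around x. The component of theta at x is
  (h_x phi_x, h_x), extended by 0. The quotient of its two entries recovers phi_x where h_x is
  nonzero, so theta separates points from closed sets and is a topological embedding. On N_x the
  component at x is (phi_x, 1); hence near x the image is a graph over the first factor E of that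
  component, and a shear straightens it to the linear embedding of E.

  The chain rule for iterated directional derivatives rests on the mean value theorem with values
  in convex open sets, which gives strict differentiability and from it linearity of the
  derivative, and on a closed formula for the derivative of d^m g(f(x); w_1(x), ..., w_m(x)).
*)
theory Submission
  imports Defs
begin

section \<open>Locally convex spaces\<close>

text \<open>Inverse function theorems fail in general locally convex spaces, so the local normal
  form of \<theta> cannot be inferred from its derivative. Using the points of M themselves as
  indices removes the difficulty: each x owns a component that near x is literally its chart, so a
  straightening chart can be written down.

  The real factor of that component has two duties. It tells a zero of h_x phi_x caused by phi_x
  from one caused by h_x, and it makes phi_x recoverable by division. One cutoff per point serves
  every neighbourhood W of x, because W meets the domain of phi_x in a set whose chart image is
  open.

  Regularity enters through the cutoffs: a subbasic open set is a preimage under a real C^r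
  function, and a bump on the line composed with that function localises in it.

  The analytic cost comes from the definition of C^r. The space of linear maps carries no norm, so
  the derivative is not treated as a map into a space of operators that could be differentiated
  again. The directions are carried along as arguments, and a composition has to be differentiated
  while its directions move with the point.\<close>

lemma lc_space_subspace: "lc_space E \<Longrightarrow> subspace (topspace E)"
  and lc_space_Hausdorff: "lc_space E \<Longrightarrow> Hausdorff_space E"
  by (auto simp: lc_space_def)

lemma lc_space_mem:
  assumes "lc_space E"
  shows lc_zero: "0 \<in> topspace E"
    and lc_add: "x \<in> topspace E \<Longrightarrow> y \<in> topspace E \<Longrightarrow> x + y \<in> topspace E"
    and lc_diff: "x \<in> topspace E \<Longrightarrow> y \<in> topspace E \<Longrightarrow> x - y \<in> topspace E"
    and lc_scaleR: "x \<in> topspace E \<Longrightarrow> c *\<^sub>R x \<in> topspace E"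
  using lc_space_subspace[OF assms]
  by (auto intro: subspace_0 subspace_add subspace_diff subspace_scale)

lemma continuous_map_fst_comp: "continuous_map Z (prod_topology X Y) f \<Longrightarrow> continuous_map Z X (\<lambda>z. fst (f z))"
  and continuous_map_snd_comp: "continuous_map Z (prod_topology X Y) f \<Longrightarrow> continuous_map Z Y (\<lambda>z. snd (f z))"
  using continuous_map_fst_of continuous_map_snd_of by (auto simp: o_def)

lemma continuous_map_compose2:
  assumes "continuous_map (prod_topology Y Z) W (\<lambda>(x, y). h x y)"
    and "continuous_map X Y f" "continuous_map X Z g"
  shows "continuous_map X W (\<lambda>x. h (f x) (g x))"
  using continuous_map_compose[OF continuous_map_pairedI[OF assms(2,3)] assms(1)]
  by (simp add: o_def)

lemma lc_continuous_add:
  assumes "lc_space F" "continuous_map X F f" "continuous_map X F g"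
  shows "continuous_map X F (\<lambda>x. f x + g x)"
  using assms by (intro continuous_map_compose2[of F F F "(+)"]) (auto simp: lc_space_def)

lemma lc_continuous_scaleR:
  assumes "lc_space F" "continuous_map X euclideanreal s" "continuous_map X F f"
  shows "continuous_map X F (\<lambda>x. s x *\<^sub>R f x)"
  using assms by (intro continuous_map_compose2[of euclideanreal F F scaleR]) (auto simp: lc_space_def)

lemma lc_continuous_diff:
  assumes "lc_space F" "continuous_map X F f" "continuous_map X F g"
  shows "continuous_map X F (\<lambda>x. f x - g x)"
  using lc_continuous_add[OF assms(1,2) lc_continuous_scaleR[OF assms(1) _ assms(3), of "\<lambda>_. -1"]]
  by simp

lemma limitin_continuous_map2:
  assumes "continuous_map (prod_topology X Y) Z (\<lambda>(x, y). h x y)"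
    and "limitin X f a G" "limitin Y g b G"
  shows "limitin Z (\<lambda>t. h (f t) (g t)) (h a b) G"
proof -
  have "limitin (prod_topology X Y) (\<lambda>t. (f t, g t)) (a, b) G"
    using assms by (simp add: limitin_pairwise o_def)
  from continuous_map_limit[OF assms(1) this] show ?thesis
    by (simp add: o_def)
qed

lemma lc_limitin_add:
  assumes "lc_space F" "limitin F f a G" "limitin F g b G"
  shows "limitin F (\<lambda>x. f x + g x) (a + b) G"
  using assms limitin_continuous_map2[of F F F "(+)"] by (auto simp: lc_space_def)

lemma lc_limitin_scaleR:
  assumes "lc_space F" "(s \<longlongrightarrow> c) G" "limitin F g b G"
  shows "limitin F (\<lambda>x. s x *\<^sub>R g x) (c *\<^sub>R b) G"
  using assms limitin_continuous_map2[of euclideanreal F F "scaleR"] by (auto simp: lc_space_def)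

lemma lc_limitin_sum:
  assumes "lc_space F" "\<And>i. i \<in> S \<Longrightarrow> limitin F (f i) (a i) G"
  shows "limitin F (\<lambda>x. \<Sum>i\<in>S. f i x) (\<Sum>i\<in>S. a i) G"
  using assms(2)
  by (induction S rule: infinite_finite_induct)
    (auto intro!: lc_limitin_add[OF assms(1)] simp: lc_zero[OF assms(1)])

lemma lc_limitin_unique:
  assumes "lc_space F" "limitin F f a G" "limitin F f b G" "G \<noteq> bot"
  shows "a = b"
  using limitin_Hausdorff_unique[OF assms(2,3) _ lc_space_Hausdorff[OF assms(1)]] assms(4) by simp

lemma lc_openin_translate:
  assumes "lc_space F" "openin F U" "a \<in> topspace F"
  shows "openin F {x \<in> topspace F. a + x \<in> U}"
proof (rule openin_continuous_map_preimage[OF _ assms(2)])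
  show "continuous_map F F ((+) a)"
    using lc_continuous_add[OF assms(1), of F "\<lambda>_. a" "\<lambda>x. x"] assms(3) by simp
qed

text \<open>Convex neighbourhoods are postulated at 0 only; translation carries them to any point.
  \<open>K\<close> is a preimage of \<open>V\<close>, hence open, and also an image of
  \<open>V\<close>, hence convex.\<close>

lemma lc_convex_neighbourhood:
  assumes "lc_space F" "openin F U" "a \<in> U"
  obtains K where "openin F K" "convex K" "a \<in> K" "K \<subseteq> U"
proof -
  note mem = lc_space_mem[OF assms(1)]
  have a: "a \<in> topspace F"
    using assms openin_subset by blast
  have "openin F {x \<in> topspace F. a + x \<in> U}" "0 \<in> {x \<in> topspace F. a + x \<in> U}"
    using lc_openin_translate[OF assms(1,2) a] assms mem by auto
  then obtain V where V: "openin F V" "0 \<in> V" "convex V" "V \<subseteq> {x \<in> topspace F. a + x \<in> U}"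
    using assms(1) unfolding lc_space_def by blast
  define K where "K = {x \<in> topspace F. -a + x \<in> V}"
  have "K = (\<lambda>x. a + x) ` V"
  proof
    show "K \<subseteq> (\<lambda>x. a + x) ` V"
    proof
      fix x assume "x \<in> K"
      then show "x \<in> (\<lambda>x. a + x) ` V"
        by (intro image_eqI[of _ _ "-a + x"]) (auto simp: K_def)
    qed
    show "(\<lambda>x. a + x) ` V \<subseteq> K"
      using V(4) a mem(2) by (auto simp: K_def)
  qed
  moreover have "openin F K"
    unfolding K_def using lc_openin_translate[OF assms(1) V(1), of "-a"] a mem(4)[of a "-1"] by simp
  ultimately show thesis
    using that[of K] V by (auto intro: convex_translation image_eqI[where x=0])
qed

section \<open>The real line, products and powers as locally convex spaces\<close>

lemma lc_space_euclideanreal: "lc_space euclideanreal"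
proof -
  have "\<exists>V. open V \<and> 0 \<in> V \<and> convex V \<and> V \<subseteq> U" if "open U" "0 \<in> U" for U :: "real set"
    using that by (metis open_contains_ball convex_ball open_ball centre_in_ball)
  moreover have "continuous_map (prod_topology euclideanreal euclideanreal) euclideanreal (\<lambda>(x, y). x + y)"
    unfolding prod_topology_euclidean case_prod_unfold continuous_map_iff_continuous2
    by (intro continuous_intros)
  moreover have "continuous_map (prod_topology euclideanreal euclideanreal) euclideanreal (\<lambda>(x, y). x *\<^sub>R y)"
    unfolding prod_topology_euclidean case_prod_unfold continuous_map_iff_continuous2
    by (intro continuous_intros)
  moreover have "subspace (topspace euclideanreal)"
    by simp
  ultimately show ?thesis
    unfolding lc_space_def by (metis Hausdorff_space_euclidean open_openin)
qed

lemma lc_space_prod: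
  assumes E: "lc_space E" and F: "lc_space F"
  shows "lc_space (prod_topology E F)"
  unfolding lc_space_def
proof (intro conjI allI impI)
  show "subspace (topspace (prod_topology E F))"
    using E F by (auto simp: lc_space_def intro: subspace_Times)
  show "Hausdorff_space (prod_topology E F)"
    using E F by (simp add: lc_space_def Hausdorff_space_prod_topology)
  show "continuous_map (prod_topology (prod_topology E F) (prod_topology E F)) (prod_topology E F) (\<lambda>(x, y). x + y)"
    by (auto simp: case_prod_unfold plus_prod_def continuous_map_paired
        intro!: lc_continuous_add[OF E] lc_continuous_add[OF F]
          continuous_map_fst_comp[of _ E F] continuous_map_snd_comp[of _ E F] continuous_map_fst continuous_map_snd)
  show "continuous_map (prod_topology euclideanreal (prod_topology E F)) (prod_topology E F) (\<lambda>(c, x). c *\<^sub>R x)"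
    by (auto simp: case_prod_unfold scaleR_prod_def continuous_map_paired
        intro!: lc_continuous_scaleR[OF E] lc_continuous_scaleR[OF F]
          continuous_map_fst_comp[of _ E F] continuous_map_snd_comp[of _ E F] continuous_map_fst continuous_map_snd)
next
  fix U :: "('a \<times> 'b) set"
  assume "openin (prod_topology E F) U \<and> 0 \<in> U"
  then obtain V W where VW: "openin E V" "openin F W" "0 \<in> V" "0 \<in> W" "V \<times> W \<subseteq> U"
    unfolding openin_prod_topology_alt zero_prod_def by blast
  obtain V' where "openin E V'" "convex V'" "0 \<in> V'" "V' \<subseteq> V"
    using lc_convex_neighbourhood[OF E VW(1,3)] by blast
  moreover obtain W' where "openin F W'" "convex W'" "0 \<in> W'" "W' \<subseteq> W"
    using lc_convex_neighbourhood[OF F VW(2,4)] by blast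
  ultimately show "\<exists>V. openin (prod_topology E F) V \<and> 0 \<in> V \<and> convex V \<and> V \<subseteq> U"
    using VW by (intro exI[of _ "V' \<times> W'"])
      (auto simp: openin_prod_Times_iff zero_prod_def intro: convex_Times)
qed

lemma topspace_lc_power:
  assumes "0 \<in> topspace F"
  shows "topspace (lc_power F I) = {f. (\<forall>i\<in>I. f i \<in> topspace F) \<and> (\<forall>i. i \<notin> I \<longrightarrow> f i = 0)}"
proof -
  have "topspace (lc_power F I) = {f. (\<forall>i. f i \<in> topspace F) \<and> (\<forall>i. i \<notin> I \<longrightarrow> f i = 0)}"
    by (auto simp: lc_power_def PiE_UNIV_domain)
  also have "\<dots> = {f. (\<forall>i\<in>I. f i \<in> topspace F) \<and> (\<forall>i. i \<notin> I \<longrightarrow> f i = 0)}"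
    using assms by (intro Collect_cong) metis
  finally show ?thesis .
qed

lemma continuous_map_lc_power:
  assumes "0 \<in> topspace F"
  shows "continuous_map X (lc_power F I) f \<longleftrightarrow>
    (\<forall>i\<in>I. continuous_map X F (\<lambda>x. f x i)) \<and> (\<forall>x\<in>topspace X. \<forall>i. i \<notin> I \<longrightarrow> f x i = 0)"
    (is "?L \<longleftrightarrow> ?R")
proof
  assume ?L
  then show ?R
    by (auto simp: lc_power_def continuous_map_in_subtopology continuous_map_componentwise_UNIV Pi_iff)
next
  assume R: ?R
  have "continuous_map X F (\<lambda>x. f x i)" for i
  proof (cases "i \<in> I")
    case False
    have "continuous_map X F (\<lambda>x. 0)"
      using assms by simp
    then show ?thesis
      by (rule continuous_map_eq) (use R False in auto)
  qed (use R in auto)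
  with R show ?L
    by (auto simp: lc_power_def continuous_map_in_subtopology continuous_map_componentwise_UNIV)
qed

lemma continuous_map_lc_power_component:
  assumes "lc_space F"
  shows "continuous_map (lc_power F I) F (\<lambda>p. p i)"
  unfolding lc_power_def
  by (intro continuous_map_from_subtopology continuous_map_product_projection) auto

text \<open>Membership in the carrier is a condition of its own: for infinite \<open>I\<close> the
  components may enter the carrier of \<open>F\<close> at different times, and the components in
  \<open>I\<close> say nothing about those off \<open>I\<close>.\<close>

lemma limitin_lc_power:
  assumes "0 \<in> topspace F"
  shows "limitin (lc_power F I) f l G \<longleftrightarrow>
    (\<forall>i\<in>I. limitin F (\<lambda>t. f t i) (l i) G) \<and> (\<forall>i. i \<notin> I \<longrightarrow> l i = 0) \<and>
    eventually (\<lambda>t. f t \<in> topspace (lc_power F I)) G"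
proof -
  have *: "limitin F (\<lambda>t. f t i) (l i) G"
    if "\<forall>i. i \<notin> I \<longrightarrow> l i = 0" "i \<notin> I" "eventually (\<lambda>t. f t \<in> topspace (lc_power F I)) G" for i
    using that assms by (auto intro!: limitin_eventually elim!: eventually_mono simp: topspace_lc_power)
  then have "(\<forall>i. limitin F (\<lambda>t. f t i) (l i) G) = (\<forall>i\<in>I. limitin F (\<lambda>t. f t i) (l i) G)"
    if "\<forall>i. i \<notin> I \<longrightarrow> l i = 0" "eventually (\<lambda>t. f t \<in> topspace (lc_power F I)) G"
    using that by blast
  then show ?thesis
    unfolding lc_power_def limitin_subtopology limitin_componentwise
    by (auto simp: eventually_conj_iff elim: eventually_mono)
qed

lemma lc_space_power:
  assumes F: "lc_space F"
  shows "lc_space (lc_power F I)"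
  unfolding lc_space_def
proof (intro conjI allI impI)
  note z = lc_zero[OF F]
  have comp: "continuous_map (lc_power F I) F (\<lambda>p. p i)" for i
    by (rule continuous_map_lc_power_component[OF F])
  show "subspace (topspace (lc_power F I))"
    using lc_space_mem[OF F] unfolding topspace_lc_power[OF z]
    by (auto simp: subspace_def scaleR_fun_def)
  show "Hausdorff_space (lc_power F I)"
    using F by (simp add: lc_space_def lc_power_def Hausdorff_space_subtopology Hausdorff_space_product_topology)
  show "continuous_map (prod_topology (lc_power F I) (lc_power F I)) (lc_power F I) (\<lambda>(x, y). x + y)"
    unfolding continuous_map_lc_power[OF z]
    by (auto simp: case_prod_unfold topspace_lc_power[OF z] plus_fun_apply
        intro!: lc_continuous_add[OF F] continuous_map_compose[OF continuous_map_fst comp, unfolded o_def]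
          continuous_map_compose[OF continuous_map_snd comp, unfolded o_def] continuous_map_fst continuous_map_snd)
  show "continuous_map (prod_topology euclideanreal (lc_power F I)) (lc_power F I) (\<lambda>(c, x). c *\<^sub>R x)"
    unfolding continuous_map_lc_power[OF z]
    by (auto simp: case_prod_unfold topspace_lc_power[OF z] scaleR_fun_def
        intro!: lc_continuous_scaleR[OF F] continuous_map_compose[OF continuous_map_snd comp, unfolded o_def]
          continuous_map_fst continuous_map_snd)
next
  note z = lc_zero[OF F]
  fix U :: "('b \<Rightarrow> 'a) set"
  assume U: "openin (lc_power F I) U \<and> 0 \<in> U"
  then obtain T where T: "openin (product_topology (\<lambda>_. F) UNIV) T" "U = T \<inter> {f. \<forall>i. i \<notin> I \<longrightarrow> f i = 0}"
    unfolding lc_power_def openin_subtopology by blast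
  then obtain X where X: "0 \<in> (\<Pi>\<^sub>E i\<in>UNIV. X i)" "\<And>i. openin F (X i)"
      "finite {i. X i \<noteq> topspace F}" "(\<Pi>\<^sub>E i\<in>UNIV. X i) \<subseteq> T"
    using product_topology_open_contains_basis[OF T(1), of 0] U by auto
  \<comment> \<open>Coordinates that are unrestricted in \<open>X\<close> must stay unrestricted in
    \<open>K\<close>. Otherwise infinitely many factors would shrink and the product would no longer
    be a basic open set.\<close>
  have "\<exists>K. openin F K \<and> convex K \<and> 0 \<in> K \<and> K \<subseteq> X i \<and> (X i = topspace F \<longrightarrow> K = topspace F)" for i
  proof (cases "X i = topspace F")
    case True
    then show ?thesis
      using F z by (intro exI[of _ "topspace F"]) (auto intro: subspace_imp_convex lc_space_subspace)
  next
    case False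
    have "0 \<in> X i"
      using X(1) by (auto simp: PiE_def)
    with False show ?thesis
      using lc_convex_neighbourhood[OF F X(2)] by metis
  qed
  then obtain K where K: "\<And>i. openin F (K i)" "\<And>i. convex (K i)" "\<And>i. 0 \<in> K i" "\<And>i. K i \<subseteq> X i"
      "\<And>i. X i = topspace F \<Longrightarrow> K i = topspace F"
    by metis
  define V where "V = (\<Pi>\<^sub>E i\<in>UNIV. K i) \<inter> {f. \<forall>i. i \<notin> I \<longrightarrow> f i = 0}"
  have "finite {i. K i \<noteq> topspace F}"
    using K(5) by (intro finite_subset[OF _ X(3)]) auto
  then have "openin (product_topology (\<lambda>_. F) UNIV) (\<Pi>\<^sub>E i\<in>UNIV. K i)"
    by (intro product_topology_basis) (auto simp: K)
  then have "openin (lc_power F I) V"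
    unfolding V_def lc_power_def openin_subtopology by blast
  moreover have "V \<subseteq> U"
  proof -
    have "(\<Pi>\<^sub>E i\<in>UNIV. K i) \<subseteq> (\<Pi>\<^sub>E i\<in>UNIV. X i)"
      using K(4) by (intro PiE_mono) auto
    then show ?thesis
      using T(2) X(4) by (auto simp: V_def)
  qed
  moreover have "convex V"
    using K(2) by (auto simp: V_def convex_def scaleR_fun_def PiE_def Pi_def)
  moreover have "0 \<in> V"
    using K(3) by (auto simp: V_def)
  ultimately show "\<exists>V. openin (lc_power F I) V \<and> 0 \<in> V \<and> convex V \<and> V \<subseteq> U"
    by blast
qed

section \<open>Mean values and strict differentiability\<close>

lemma openin_prod_topology_nbhd:
  assumes "openin (prod_topology X Y) S" "(x, y) \<in> S"
  obtains U V where "openin X U" "openin Y V" "x \<in> U" "y \<in> V" "U \<times> V \<subseteq> S"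
  using openin_prod_topology_alt[THEN iffD1, OF assms(1), rule_format, OF assms(2)] that by auto

lemma limitin_compose_filterlim:
  assumes "limitin X f l G" "filterlim h G H"
  shows "limitin X (\<lambda>t. f (h t)) l H"
  using assms by (auto simp: limitin_def dest: eventually_compose_filterlim)

text \<open>The mean slope over a union of two adjacent intervals is a convex combination of the two
  mean slopes. Since \<open>K\<close> is open, slopes from a point to nearby points lie in
  \<open>K\<close>. The bisection principle \<open>Bolzano\<close> passes from this local statement
  to the whole of [0, 1].\<close>

lemma lc_mean_value:
  assumes F: "lc_space F" and K: "openin F K" "convex K"
    and c: "\<And>s. 0 \<le> s \<Longrightarrow> s \<le> 1 \<Longrightarrow>
      \<exists>l\<in>K. limitin F (\<lambda>t. (1 / t) *\<^sub>R (c (s + t) - c s)) l (at 0)"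
  shows "c 1 - c (0::real) \<in> K"
proof -
  define P where "P a b \<longleftrightarrow> (a < b \<longrightarrow> (\<exists>k\<in>K. c b - c a = (b - a) *\<^sub>R k))" for a b
  have trans: "P a d" if "P a b" "P b d" "a \<le> b" "b \<le> d" for a b d
  proof (cases "a = b \<or> b = d")
    case True
    with that show ?thesis by auto
  next
    case False
    with that obtain k k' where k: "k \<in> K" "c b - c a = (b - a) *\<^sub>R k" "k' \<in> K" "c d - c b = (d - b) *\<^sub>R k'"
      by (auto simp: P_def)
    \<comment> \<open>The weight of the left slope is the share of [a, b] in the length of
      [a, d].\<close>
    define u where "u = (b - a) / (d - a)"
    have u: "0 \<le> u" "0 \<le> 1 - u" "u + (1 - u) = 1"
      using that False by (simp_all add: u_def)
    have "(d - a) * u = b - a"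
      using that False by (simp add: u_def)
    then have "(d - a) * (1 - u) = d - b"
      by (simp add: algebra_simps)
    then have "(d - a) *\<^sub>R (u *\<^sub>R k + (1 - u) *\<^sub>R k') = (b - a) *\<^sub>R k + (d - b) *\<^sub>R k'"
      using \<open>(d - a) * u = b - a\<close> by (simp add: scaleR_add_right)
    also have "\<dots> = c d - c a"
      using k by (simp flip: k(2,4))
    finally show ?thesis
      using convexD[OF K(2) k(1,3) u] unfolding P_def by metis
  qed
  have "P 0 1"
  proof (rule Bolzano)
    show "(0::real) \<le> 1" by simp
    show "P a d" if "P a b" "P b d" "a \<le> b" "b \<le> d" for a b d
      using trans that .
  next
    fix x :: real assume "0 \<le> x" "x \<le> 1"
    then obtain l where "l \<in> K" "limitin F (\<lambda>t. (1 / t) *\<^sub>R (c (x + t) - c x)) l (at 0)"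
      using c by blast
    then have "eventually (\<lambda>t. (1 / t) *\<^sub>R (c (x + t) - c x) \<in> K) (at 0)"
      using K(1) by (simp add: limitin_def)
    then obtain d where d: "d > 0" "\<And>t. t \<noteq> 0 \<Longrightarrow> \<bar>t\<bar> < d \<Longrightarrow> (1 / t) *\<^sub>R (c (x + t) - c x) \<in> K"
      by (auto simp: eventually_at)
    have 1: "P x b" if "x \<le> b" "b - x < d" for b
    proof (cases "x = b")
      case False
      then have "(1 / (b - x)) *\<^sub>R (c (x + (b - x)) - c x) \<in> K"
        using that by (intro d(2)) auto
      with False show ?thesis
        unfolding P_def by (intro impI bexI) auto
    qed (simp add: P_def)
    have 2: "P a x" if "a \<le> x" "x - a < d" for a
    proof (cases "x = a")
      case False
      then have "(1 / (a - x)) *\<^sub>R (c (x + (a - x)) - c x) \<in> K"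
        using that by (intro d(2)) auto
      \<comment> \<open>The increment \<open>a - x\<close> is negative; the factor -1 coming from
        the two lengths turns \<open>c a - c x\<close> into \<open>c x - c a\<close>.\<close>
      moreover have "c x - c a = (x - a) *\<^sub>R (1 / (a - x)) *\<^sub>R (c (x + (a - x)) - c x)"
      proof -
        have "(x - a) * (1 / (a - x)) = -1"
          using False by (simp add: field_simps)
        then show ?thesis
          by (simp only: scaleR_scaleR) simp
      qed
      ultimately show ?thesis
        unfolding P_def by blast
    qed (simp add: P_def)
    \<comment> \<open>Slopes are controlled only with \<open>x\<close> as an end point, so an
      interval around \<open>x\<close> is cut at \<open>x\<close>.\<close>
    show "\<exists>d>0. \<forall>a b. a \<le> x \<and> x \<le> b \<and> b - a < d \<longrightarrow> P a b"
      using d(1) by (intro exI[of _ d] conjI allI impI trans[OF 2 1]) auto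
  qed
  then show ?thesis
    by (auto simp: P_def)
qed

text \<open>Base point, direction and step all vary along the filter. The difference quotient is the
  total increment of a curve along a short segment; the velocities of that curve are values of
  \<open>g'\<close> close to \<open>g' u l\<close>, hence in a convex neighbourhood
  \<open>K\<close>, and the mean value theorem puts the increment into \<open>K\<close> as
  well.\<close>

lemma lc_strict_derivative:
  assumes E: "lc_space E" and F: "lc_space F" and V: "openin E V" "u \<in> V"
    and d: "\<And>v y. v \<in> V \<Longrightarrow> y \<in> topspace E \<Longrightarrow> has_dir_deriv F g v y (g' v y)"
    and cont: "continuous_map (prod_topology (subtopology E V) E) F (\<lambda>(v, y). g' v y)"
    and a: "limitin E a u G" and w: "limitin E w l G"
    and \<tau>: "(\<tau> \<longlongrightarrow> 0) G" "eventually (\<lambda>t. \<tau> t \<noteq> 0) G"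
  shows "limitin F (\<lambda>t. (1 / \<tau> t) *\<^sub>R (g (a t + \<tau> t *\<^sub>R w t) - g (a t))) (g' u l) G"
  unfolding limitin_def
proof (intro conjI allI impI)
  have l: "l \<in> topspace E" and u: "u \<in> topspace E"
    using w a by (auto simp: limitin_def)
  show "g' u l \<in> topspace F"
    using d[OF V(2) l] by (auto simp: has_dir_deriv_def limitin_def)
  fix O' assume "openin F O' \<and> g' u l \<in> O'"
  then obtain K where K: "openin F K" "convex K" "g' u l \<in> K" "K \<subseteq> O'"
    using lc_convex_neighbourhood[OF F, of O' "g' u l"] by auto
  have "openin (prod_topology (subtopology E V) E)
      {z \<in> topspace (prod_topology (subtopology E V) E). (case z of (v, y) \<Rightarrow> g' v y) \<in> K}" (is "openin _ ?S")
    using cont K(1) by (rule openin_continuous_map_preimage)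
  moreover have "(u, l) \<in> ?S"
    using u l V K(3) by auto
  ultimately obtain N1 N2 where N: "openin (subtopology E V) N1" "openin E N2" "u \<in> N1" "l \<in> N2" "N1 \<times> N2 \<subseteq> ?S"
    by (rule openin_prod_topology_nbhd)
  have N1: "openin E N1" "N1 \<subseteq> V"
    using N(1) V(1) by (auto simp: openin_open_subtopology)
  \<comment> \<open>Continuity of (a, w, s) \<mapsto> a + s w at (u, l, 0) keeps the entire segment,
    not only its end points, inside \<open>N1\<close>.\<close>
  have "continuous_map (prod_topology E (prod_topology E euclideanreal)) E
      (\<lambda>z. fst z + snd (snd z) *\<^sub>R fst (snd z))"
    by (intro lc_continuous_add[OF E] lc_continuous_scaleR[OF E] continuous_map_fst
        continuous_map_fst_comp[OF continuous_map_snd] continuous_map_snd_comp[OF continuous_map_snd])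
  from openin_continuous_map_preimage[OF this N1(1)]
  have "openin (prod_topology E (prod_topology E euclideanreal))
      {z \<in> topspace (prod_topology E (prod_topology E euclideanreal)).
        fst z + snd (snd z) *\<^sub>R fst (snd z) \<in> N1}" (is "openin _ ?T") .
  moreover have "(u, (l, 0)) \<in> ?T"
    using u l N(3) by simp
  ultimately obtain A B where A: "openin E A" "openin (prod_topology E euclideanreal) B" "u \<in> A" "(l, 0) \<in> B" "A \<times> B \<subseteq> ?T"
    by (rule openin_prod_topology_nbhd)
  obtain C D where C: "openin E C" "openin euclideanreal D" "l \<in> C" "0 \<in> D" "C \<times> D \<subseteq> B"
    using A(2,4) by (rule openin_prod_topology_nbhd)
  obtain e where e: "e > 0" "ball 0 e \<subseteq> D"
    using C(2,4) by (metis open_contains_ball open_openin)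
  have "eventually (\<lambda>t. a t \<in> A) G" "eventually (\<lambda>t. w t \<in> C) G" "eventually (\<lambda>t. w t \<in> N2) G"
    using a w A C N by (auto simp: limitin_def)
  moreover have "eventually (\<lambda>t. \<bar>\<tau> t\<bar> < e) G"
    using tendstoD[OF \<tau>(1) e(1)] by simp
  ultimately have "eventually (\<lambda>t. a t \<in> A \<and> w t \<in> C \<and> w t \<in> N2 \<and> \<bar>\<tau> t\<bar> < e \<and> \<tau> t \<noteq> 0) G"
    using \<tau>(2) by (simp add: eventually_conj_iff)
  then show "eventually (\<lambda>t. (1 / \<tau> t) *\<^sub>R (g (a t + \<tau> t *\<^sub>R w t) - g (a t)) \<in> O') G"
  proof (rule eventually_mono)
    fix t assume t: "a t \<in> A \<and> w t \<in> C \<and> w t \<in> N2 \<and> \<bar>\<tau> t\<bar> < e \<and> \<tau> t \<noteq> 0"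
    \<comment> \<open>With the factor \<open>1 / \<tau> t\<close> built in, \<open>c 1 - c 0\<close>
      is the difference quotient itself and the derivative of \<open>c\<close> is a plain value of
      \<open>g'\<close>.\<close>
    define c where "c s = (1 / \<tau> t) *\<^sub>R g (a t + (s * \<tau> t) *\<^sub>R w t)" for s
    have wt: "w t \<in> topspace E"
      using t N(2) openin_subset by blast
    have in_N1: "a t + (s * \<tau> t) *\<^sub>R w t \<in> N1" if "0 \<le> s" "s \<le> 1" for s
    proof -
      have "\<bar>s * \<tau> t\<bar> \<le> 1 * \<bar>\<tau> t\<bar>"
        unfolding abs_mult using that by (intro mult_right_mono) auto
      then have "s * \<tau> t \<in> D"
        using t e(2) by (auto simp: subset_iff)
      then have "(a t, (w t, s * \<tau> t)) \<in> A \<times> B"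
        using t C(5) by auto
      then have "(a t, (w t, s * \<tau> t)) \<in> ?T"
        using A(5) by blast
      then show ?thesis by simp
    qed
    have "c 1 - c 0 \<in> K"
    proof (rule lc_mean_value[OF F K(1,2)])
      fix s :: real assume s: "0 \<le> s" "s \<le> 1"
      define v where "v = a t + (s * \<tau> t) *\<^sub>R w t"
      have v: "v \<in> N1"
        using in_N1[OF s] by (simp add: v_def)
      have "has_dir_deriv F g v (w t) (g' v (w t))"
        using v N1(2) wt by (intro d) auto
      moreover have "filterlim (\<lambda>h. h * \<tau> t) (at 0) (at 0)"
      proof -
        have "((\<lambda>h. h * \<tau> t) \<longlongrightarrow> 0 * \<tau> t) (at 0)"
          by (intro tendsto_intros)
        then show ?thesis
          using t by (auto simp: filterlim_at eventually_at intro!: exI[of _ 1])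
      qed
      ultimately have "limitin F (\<lambda>h. (1 / (h * \<tau> t)) *\<^sub>R (g (v + (h * \<tau> t) *\<^sub>R w t) - g v)) (g' v (w t)) (at 0)"
        unfolding has_dir_deriv_def by (rule limitin_compose_filterlim)
      moreover have "(1 / (h * \<tau> t)) *\<^sub>R (g (v + (h * \<tau> t) *\<^sub>R w t) - g v) = (1 / h) *\<^sub>R (c (s + h) - c s)" for h
        unfolding c_def v_def by (simp add: algebra_simps flip: scaleR_diff_right)
      moreover have "g' v (w t) \<in> K"
        using subsetD[OF N(5), of "(v, w t)"] v t by simp
      ultimately show "\<exists>l\<in>K. limitin F (\<lambda>h. (1 / h) *\<^sub>R (c (s + h) - c s)) l (at 0)"
        by auto
    qed
    then show "(1 / \<tau> t) *\<^sub>R (g (a t + \<tau> t *\<^sub>R w t) - g (a t)) \<in> O'"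
      using K(4) by (auto simp: c_def scaleR_diff_right)
  qed
qed

text \<open>Write \<open>c t\<close> as \<open>c 0\<close> plus \<open>t\<close> times the
  difference quotient of \<open>c\<close>. This is a step of size \<open>t\<close> in a direction
  that moves and converges to \<open>l\<close>, a case of strict differentiability.\<close>

lemma lc_curve_chain:
  assumes E: "lc_space E" and F: "lc_space F" and V: "openin E V" "c 0 \<in> V"
    and d: "\<And>v y. v \<in> V \<Longrightarrow> y \<in> topspace E \<Longrightarrow> has_dir_deriv F g v y (g' v y)"
    and cont: "continuous_map (prod_topology (subtopology E V) E) F (\<lambda>(v, y). g' v y)"
    and c: "limitin E (\<lambda>t. (1 / t) *\<^sub>R (c t - c 0)) l (at 0)"
  shows "limitin F (\<lambda>t. (1 / t) *\<^sub>R (g (c t) - g (c 0))) (g' (c 0) l) (at (0::real))"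
proof -
  have c0: "limitin E (\<lambda>t. c 0) (c 0) (at (0::real))"
    using V openin_subset by fastforce
  have nz: "eventually (\<lambda>t::real. t \<noteq> 0) (at 0)"
    by (simp add: eventually_at_filter)
  have "limitin F (\<lambda>t. (1 / t) *\<^sub>R (g (c 0 + t *\<^sub>R ((1 / t) *\<^sub>R (c t - c 0))) - g (c 0))) (g' (c 0) l) (at 0)"
    by (rule lc_strict_derivative[OF E F V(1,2) d cont c0 c _ nz]) (auto intro: tendsto_ident_at)
  then show ?thesis
    by (rule limitin_transform_eventually[rotated]) (use nz in \<open>auto elim!: eventually_mono\<close>)
qed

lemma lc_curve_continuous:
  assumes E: "lc_space E" and "c 0 \<in> topspace E" "limitin E (\<lambda>t. (1 / t) *\<^sub>R (c t - c 0)) l (at 0)"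
  shows "limitin E c (c 0) (at (0::real))"
proof -
  have nz: "eventually (\<lambda>t::real. t \<noteq> 0) (at 0)"
    by (simp add: eventually_at_filter)
  have "limitin E (\<lambda>t. c 0 + t *\<^sub>R ((1 / t) *\<^sub>R (c t - c 0))) (c 0 + 0 *\<^sub>R l) (at 0)"
    by (intro lc_limitin_add[OF E] lc_limitin_scaleR[OF E]) (use assms in \<open>auto intro: tendsto_ident_at\<close>)
  then have "limitin E (\<lambda>t. c 0 + t *\<^sub>R ((1 / t) *\<^sub>R (c t - c 0))) (c 0) (at 0)"
    by simp
  then show ?thesis
    by (rule limitin_transform_eventually[rotated]) (use nz in \<open>auto elim!: eventually_mono\<close>)
qed

lemma lc_line_limit:
  assumes E: "lc_space E" and "x \<in> topspace E" "y \<in> topspace E"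
  shows "limitin E (\<lambda>t. x + t *\<^sub>R y) x (at (0::real))"
proof -
  have "limitin E (\<lambda>t. x + t *\<^sub>R y) (x + 0 *\<^sub>R y) (at (0::real))"
    by (intro lc_limitin_add[OF E] lc_limitin_scaleR[OF E]) (use assms in \<open>auto intro: tendsto_ident_at\<close>)
  then show ?thesis by simp
qed

lemma lc_line_eventually:
  assumes "lc_space E" "openin E U" "x \<in> U" "y \<in> topspace E"
  shows "eventually (\<lambda>t. x + t *\<^sub>R y \<in> U) (at (0::real))"
  using limitinD[OF lc_line_limit[OF assms(1) _ assms(4)] assms(2,3)] openin_subset[OF assms(2)] assms(3)
  by blast

text \<open>For additivity the increment along \<open>y1 + y2\<close> is split at the point
  \<open>u + t *\<^sub>R y1\<close>. The second part is a difference quotient with moving base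
  point, which is where strictness is needed. Homogeneity is the substitution of
  \<open>t * c\<close> for \<open>t\<close>, with c = 0 treated apart.\<close>

lemma lc_derivative_linear:
  assumes E: "lc_space E" and F: "lc_space F" and V: "openin E V" "u \<in> V"
    and d: "\<And>v y. v \<in> V \<Longrightarrow> y \<in> topspace E \<Longrightarrow> has_dir_deriv F g v y (g' v y)"
    and cont: "continuous_map (prod_topology (subtopology E V) E) F (\<lambda>(v, y). g' v y)"
  shows "linear_between E F (g' u)"
  unfolding linear_between_def
proof (intro conjI ballI allI)
  have u: "u \<in> topspace E"
    using V openin_subset by blast
  have nz: "eventually (\<lambda>t::real. t \<noteq> 0) (at 0)"
    by (simp add: eventually_at_filter)
  show "g' u ` topspace E \<subseteq> topspace F"
    using d[OF V(2)] by (auto simp: has_dir_deriv_def limitin_def)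
  fix y1 assume y1: "y1 \<in> topspace E"
  {
    fix y2 assume y2: "y2 \<in> topspace E"
    have "limitin F (\<lambda>t. (1 / t) *\<^sub>R (g ((u + t *\<^sub>R y1) + t *\<^sub>R y2) - g (u + t *\<^sub>R y1))) (g' u y2) (at 0)"
      by (rule lc_strict_derivative[OF E F V d cont lc_line_limit[OF E u y1] _ _ nz])
        (use y2 in \<open>auto intro: tendsto_ident_at\<close>)
    moreover have "limitin F (\<lambda>t. (1 / t) *\<^sub>R (g (u + t *\<^sub>R y1) - g u)) (g' u y1) (at 0)"
      using d[OF V(2) y1] by (simp add: has_dir_deriv_def)
    ultimately have "limitin F (\<lambda>t. (1 / t) *\<^sub>R (g (u + t *\<^sub>R y1) - g u)
        + (1 / t) *\<^sub>R (g ((u + t *\<^sub>R y1) + t *\<^sub>R y2) - g (u + t *\<^sub>R y1))) (g' u y1 + g' u y2) (at 0)"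
      by (intro lc_limitin_add[OF F])
    then have "limitin F (\<lambda>t. (1 / t) *\<^sub>R (g (u + t *\<^sub>R (y1 + y2)) - g u)) (g' u y1 + g' u y2) (at 0)"
      by (simp add: scaleR_add_right add.assoc flip: scaleR_add_right[of "1 / _"])
    moreover have "limitin F (\<lambda>t. (1 / t) *\<^sub>R (g (u + t *\<^sub>R (y1 + y2)) - g u)) (g' u (y1 + y2)) (at 0)"
      using d[OF V(2) lc_add[OF E y1 y2]] by (simp add: has_dir_deriv_def)
    ultimately show "g' u (y1 + y2) = g' u y1 + g' u y2"
      using lc_limitin_unique[OF F] by fastforce
  }
  fix c :: real
  have y: "limitin F (\<lambda>t. (1 / t) *\<^sub>R (g (u + t *\<^sub>R (c *\<^sub>R y1)) - g u)) (g' u (c *\<^sub>R y1)) (at 0)"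
    using d[OF V(2) lc_scaleR[OF E y1]] by (simp add: has_dir_deriv_def)
  show "g' u (c *\<^sub>R y1) = c *\<^sub>R g' u y1"
  proof (cases "c = 0")
    case True
    with y have "limitin F (\<lambda>t::real. 0) (g' u (c *\<^sub>R y1)) (at 0)"
      by simp
    moreover have "limitin F (\<lambda>t::real. 0) 0 (at 0)"
      using lc_zero[OF F] by simp
    ultimately have "g' u (c *\<^sub>R y1) = 0"
      by (rule lc_limitin_unique[OF F]) simp
    with True show ?thesis by simp
  next
    case False
    have "filterlim (\<lambda>t. t * c) (at 0) (at 0)"
    proof -
      have "((\<lambda>t. t * c) \<longlongrightarrow> 0 * c) (at 0)"
        by (intro tendsto_intros)
      then show ?thesis
        using False by (auto simp: filterlim_at eventually_at intro!: exI[of _ 1])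
    qed
    then have "limitin F (\<lambda>t. (1 / (t * c)) *\<^sub>R (g (u + (t * c) *\<^sub>R y1) - g u)) (g' u y1) (at 0)"
      by (rule limitin_compose_filterlim[OF d[OF V(2) y1, unfolded has_dir_deriv_def]])
    then have "limitin F (\<lambda>t. c *\<^sub>R (1 / (t * c)) *\<^sub>R (g (u + (t * c) *\<^sub>R y1) - g u)) (c *\<^sub>R g' u y1) (at 0)"
      by (intro lc_limitin_scaleR[OF F]) auto
    then have "limitin F (\<lambda>t. (1 / t) *\<^sub>R (g (u + t *\<^sub>R (c *\<^sub>R y1)) - g u)) (c *\<^sub>R g' u y1) (at 0)"
      using False by simp
    with y show ?thesis
      by (rule lc_limitin_unique[OF F]) simp
  qed
qed

section \<open>Directional derivatives\<close>

lemma has_dir_deriv_eq: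
  assumes "lc_space F" "has_dir_deriv F f x y l"
  shows "dir_deriv F f x y = l"
  unfolding dir_deriv_def
proof (rule the_equality)
  show "m = l" if "has_dir_deriv F f x y m" for m
    using lc_limitin_unique[OF assms(1) that[unfolded has_dir_deriv_def] assms(2)[unfolded has_dir_deriv_def]]
    by simp
qed fact

lemma has_dir_deriv_cong:
  assumes "lc_space E" "openin E U" "x \<in> U" "y \<in> topspace E" "\<And>z. z \<in> U \<Longrightarrow> f z = g z"
  shows "has_dir_deriv F f x y l \<longleftrightarrow> has_dir_deriv F g x y l"
proof -
  have 1: "eventually (\<lambda>t::real. (1 / t) *\<^sub>R (f (x + t *\<^sub>R y) - f x) = (1 / t) *\<^sub>R (g (x + t *\<^sub>R y) - g x)) (at 0)"
    using lc_line_eventually[OF assms(1-4)] by (rule eventually_mono) (simp add: assms(3,5))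
  then have 2: "eventually (\<lambda>t::real. (1 / t) *\<^sub>R (g (x + t *\<^sub>R y) - g x) = (1 / t) *\<^sub>R (f (x + t *\<^sub>R y) - f x)) (at 0)"
    by (rule eventually_mono) (rule sym)
  show ?thesis
    unfolding has_dir_deriv_def
    by (rule iffI) (erule limitin_transform_eventually[OF 1], erule limitin_transform_eventually[OF 2])
qed

lemma dir_deriv_cong:
  assumes "lc_space E" "openin E U" "x \<in> U" "y \<in> topspace E" "\<And>z. z \<in> U \<Longrightarrow> f z = g z"
  shows "dir_deriv F f x y = dir_deriv F g x y"
proof -
  have "has_dir_deriv F f x y = has_dir_deriv F g x y"
    using has_dir_deriv_cong[OF assms(1-4), of f g F] assms(5) by blast
  then show ?thesis
    by (simp add: dir_deriv_def)
qed

lemma has_dir_deriv_limit: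
  assumes "lc_space F" "f x \<in> topspace F" "has_dir_deriv F f x y l"
  shows "limitin F (\<lambda>t. f (x + t *\<^sub>R y)) (f x) (at (0::real))"
  using lc_curve_continuous[OF assms(1), of "\<lambda>t. f (x + t *\<^sub>R y)" l] assms(2,3)
  by (simp add: has_dir_deriv_def)

lemma has_dir_deriv_const: "lc_space F \<Longrightarrow> has_dir_deriv F (\<lambda>_. c) x y 0"
  by (simp add: has_dir_deriv_def lc_zero)

lemma has_dir_deriv_id:
  assumes "y \<in> topspace E"
  shows "has_dir_deriv E (\<lambda>z. z) x y y"
  unfolding has_dir_deriv_def
  by (rule limitin_eventually) (use assms in \<open>auto simp: eventually_at_filter\<close>)

lemma has_dir_deriv_add:
  assumes "lc_space F" "has_dir_deriv F f x y l" "has_dir_deriv F g x y m"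
  shows "has_dir_deriv F (\<lambda>z. f z + g z) x y (l + m)"
  using lc_limitin_add[OF assms(1) assms(2,3)[unfolded has_dir_deriv_def]]
  by (simp add: has_dir_deriv_def algebra_simps)

lemma has_dir_deriv_scaleR:
  assumes F: "lc_space F" and "f x \<in> topspace F"
    and s: "has_dir_deriv euclideanreal s x y s'" and f: "has_dir_deriv F f x y l"
  shows "has_dir_deriv F (\<lambda>z. s z *\<^sub>R f z) x y (s' *\<^sub>R f x + s x *\<^sub>R l)"
proof -
  have "limitin F (\<lambda>t. ((1 / t) *\<^sub>R (s (x + t *\<^sub>R y) - s x)) *\<^sub>R f (x + t *\<^sub>R y)
      + s x *\<^sub>R ((1 / t) *\<^sub>R (f (x + t *\<^sub>R y) - f x))) (s' *\<^sub>R f x + s x *\<^sub>R l) (at 0)"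
    using s f[unfolded has_dir_deriv_def] unfolding has_dir_deriv_def limitin_canonical_iff
    by (intro lc_limitin_add[OF F] lc_limitin_scaleR[OF F] tendsto_const
        has_dir_deriv_limit[OF F _ f] assms(2))
  then show ?thesis
    by (simp add: has_dir_deriv_def algebra_simps)
qed

text \<open>\<open>L\<close> is linear on the carrier of \<open>F\<close> only, so it can be moved
  inside the difference quotient only while \<open>f\<close> has values there; the open set
  \<open>U\<close> guarantees this for small increments.\<close>

lemma has_dir_deriv_linear:
  assumes F: "lc_space F" and L: "linear_between F H L" "continuous_map F H L"
    and E: "lc_space E" "openin E U" "x \<in> U" "y \<in> topspace E" "\<And>z. z \<in> U \<Longrightarrow> f z \<in> topspace F"
    and f: "has_dir_deriv F f x y l"
  shows "has_dir_deriv H (\<lambda>z. L (f z)) x y (L l)"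
proof -
  note mem = lc_space_mem[OF F]
  have diff: "L (a - b) = L a - L b" if "a \<in> topspace F" "b \<in> topspace F" for a b
  proof -
    have "L (a - b) + L b = L (a - b + b)"
      using L(1) mem that unfolding linear_between_def by metis
    then show ?thesis by (simp add: eq_diff_eq)
  qed
  have "limitin H (\<lambda>t. L ((1 / t) *\<^sub>R (f (x + t *\<^sub>R y) - f x))) (L l) (at 0)"
    using continuous_map_limit[OF L(2) f[unfolded has_dir_deriv_def]] by (simp add: o_def)
  moreover have "eventually (\<lambda>t. L ((1 / t) *\<^sub>R (f (x + t *\<^sub>R y) - f x)) = (1 / t) *\<^sub>R (L (f (x + t *\<^sub>R y)) - L (f x))) (at 0)"
    using lc_line_eventually[OF E(1-4)]
  proof (rule eventually_mono)
    fix t :: real assume "x + t *\<^sub>R y \<in> U"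
    then have "f (x + t *\<^sub>R y) \<in> topspace F" "f x \<in> topspace F"
      using E by auto
    then show "L ((1 / t) *\<^sub>R (f (x + t *\<^sub>R y) - f x)) = (1 / t) *\<^sub>R (L (f (x + t *\<^sub>R y)) - L (f x))"
      using L(1) mem diff by (simp add: linear_between_def)
  qed
  ultimately show ?thesis
    unfolding has_dir_deriv_def by (rule limitin_transform_eventually[rotated])
qed

lemma has_dir_deriv_pair:
  "has_dir_deriv (prod_topology F H) f x y l \<longleftrightarrow>
    has_dir_deriv F (\<lambda>z. fst (f z)) x y (fst l) \<and> has_dir_deriv H (\<lambda>z. snd (f z)) x y (snd l)"
  by (simp add: has_dir_deriv_def limitin_pairwise o_def)

text \<open>The neighbourhood \<open>U\<close> supplies the eventual membership in the carrier,
  which convergence of the components does not give.\<close>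

lemma has_dir_deriv_power:
  assumes F: "lc_space F"
    and E: "lc_space E" "openin E U" "x \<in> U" "y \<in> topspace E" "\<And>z. z \<in> U \<Longrightarrow> f z \<in> topspace (lc_power F I)"
    and l: "\<And>i. i \<notin> I \<Longrightarrow> l i = 0"
    and d: "\<And>i. i \<in> I \<Longrightarrow> has_dir_deriv F (\<lambda>z. f z i) x y (l i)"
  shows "has_dir_deriv (lc_power F I) f x y l"
  unfolding has_dir_deriv_def limitin_lc_power[OF lc_zero[OF F]]
proof (intro conjI ballI allI impI)
  show "eventually (\<lambda>t. (1 / t) *\<^sub>R (f (x + t *\<^sub>R y) - f x) \<in> topspace (lc_power F I)) (at 0)"
    using lc_line_eventually[OF E(1-4)] 
    by (rule eventually_mono) (intro lc_scaleR lc_diff lc_space_power F E)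
  show "limitin F (\<lambda>t. ((1 / t) *\<^sub>R (f (x + t *\<^sub>R y) - f x)) i) (l i) (at 0)" if "i \<in> I" for i
    using d[OF that] by (simp add: has_dir_deriv_def scaleR_fun_def)
qed (use l in auto)

section \<open>Differentiability classes of maps with parameters\<close>

text \<open>The iterated derivatives of a map depend on a growing list of directions. To keep the types
  fixed, all maps get a sequence of vectors of \<open>E\<close> as a parameter; differentiation
  pushes the new direction onto the front of this sequence.\<close>

definition Par :: "'a topology \<Rightarrow> (nat \<Rightarrow> 'a) topology" where
  "Par E = product_topology (\<lambda>_. E) UNIV"

lemma Par_iff: "p \<in> topspace (Par E) \<longleftrightarrow> (\<forall>i. p i \<in> topspace E)"
  by (auto simp: Par_def)

lemma continuous_map_Par: "continuous_map X (Par E) f \<longleftrightarrow> (\<forall>i. continuous_map X E (\<lambda>x. f x i))"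
  by (auto simp: Par_def continuous_map_componentwise_UNIV)

lemma continuous_map_Par_component_of:
  "continuous_map X (Par E) f \<Longrightarrow> continuous_map X E (\<lambda>x. f x i)"
  by (simp add: continuous_map_Par)

definition par_deriv ::
  "'b::real_vector topology \<Rightarrow> ('a::real_vector \<Rightarrow> (nat \<Rightarrow> 'a) \<Rightarrow> 'b) \<Rightarrow> 'a \<Rightarrow> (nat \<Rightarrow> 'a) \<Rightarrow> 'b" where
  "par_deriv F f x p = dir_deriv F (\<lambda>z. f z (\<lambda>i. p (Suc i))) x (p 0)"

abbreviation cont_on ::
  "'a::real_vector topology \<Rightarrow> 'b::real_vector topology \<Rightarrow> 'a set \<Rightarrow> ('a \<Rightarrow> (nat \<Rightarrow> 'a) \<Rightarrow> 'b) \<Rightarrow> bool" where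
  "cont_on E F U f \<equiv> continuous_map (prod_topology (subtopology E U) (Par E)) F (\<lambda>z. f (fst z) (snd z))"

text \<open>Since \<open>par_deriv F f\<close> has the same type as \<open>f\<close>, the class can
  be defined by recursion on the order, and its closure properties become inductions on
  \<open>k\<close> for arbitrary \<open>f\<close>. Only \<open>x\<close> is differentiated; the
  parameters stay frozen in the derivative and enter through joint continuity.\<close>

primrec Ck_par ::
  "'a::real_vector topology \<Rightarrow> 'b::real_vector topology \<Rightarrow> 'a set \<Rightarrow> nat \<Rightarrow> ('a \<Rightarrow> (nat \<Rightarrow> 'a) \<Rightarrow> 'b) \<Rightarrow> bool" where
  "Ck_par E F U 0 f \<longleftrightarrow> cont_on E F U f"
| "Ck_par E F U (Suc k) f \<longleftrightarrow> cont_on E F U f \<and>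
     (\<forall>x\<in>U. \<forall>p\<in>topspace (Par E).
        has_dir_deriv F (\<lambda>z. f z (\<lambda>i. p (Suc i))) x (p 0) (par_deriv F f x p)) \<and>
     Ck_par E F U k (par_deriv F f)"

lemma Ck_par_cont: "Ck_par E F U k f \<Longrightarrow> cont_on E F U f"
  by (cases k) auto

lemma Ck_par_D: "Ck_par E F U (Suc k) f \<Longrightarrow> Ck_par E F U k f"
  by (induction k arbitrary: f) auto

lemma Ck_par_mono: "Ck_par E F U k f \<Longrightarrow> j \<le> k \<Longrightarrow> Ck_par E F U j f"
  using inc_induct[of j k "\<lambda>j. Ck_par E F U j f"] Ck_par_D by blast

lemma Par_Suc: "p \<in> topspace (Par E) \<Longrightarrow> (\<lambda>i. p (Suc i)) \<in> topspace (Par E)"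
  unfolding Par_iff by blast

lemma cont_on_in:
  assumes "openin E U" "cont_on E F U f" "x \<in> U" "p \<in> topspace (Par E)"
  shows "f x p \<in> topspace F"
proof -
  have "(x, p) \<in> topspace (prod_topology (subtopology E U) (Par E))"
    using assms(3,4) openin_subset[OF assms(1)] by auto
  from continuous_map_image_subset_topspace[OF assms(2)] this show ?thesis
    by (auto simp only: image_subset_iff fst_conv snd_conv)
qed

lemma Ck_par_in:
  assumes "openin E U" "Ck_par E F U k f" "x \<in> U" "p \<in> topspace (Par E)"
  shows "f x p \<in> topspace F"
  using cont_on_in[OF assms(1) Ck_par_cont[OF assms(2)] assms(3,4)] .

lemma cont_on_cong:
  assumes "openin E U" "\<And>x p. x \<in> U \<Longrightarrow> p \<in> topspace (Par E) \<Longrightarrow> f x p = g x p" "cont_on E F U f"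
  shows "cont_on E F U g"
  using assms(3)
  by (rule continuous_map_eq) (use assms(2) in \<open>auto simp only: topspace_prod_topology mem_Times_iff topspace_subtopology\<close>)

lemma cont_on_subset:
  assumes "N \<subseteq> U" "cont_on E F U f"
  shows "cont_on E F N f"
proof -
  have "prod_topology (subtopology E N) (Par E)
      = subtopology (prod_topology (subtopology E U) (Par E)) (N \<times> topspace (Par E))"
    using assms(1) by (simp add: subtopology_Times subtopology_subtopology Int_absorb1)
  then show ?thesis
    using continuous_map_from_subtopology[OF assms(2)] by metis
qed

lemma cont_on_local:
  assumes U: "openin E U" and "\<And>x. x \<in> U \<Longrightarrow> \<exists>N. openin E N \<and> x \<in> N \<and> N \<subseteq> U \<and> cont_on E F N f"
  shows "cont_on E F U f"
proof -
  obtain N where N: "\<And>x. x \<in> U \<Longrightarrow> openin E (N x) \<and> x \<in> N x \<and> N x \<subseteq> U \<and> cont_on E F (N x) f"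
    using assms by metis
  let ?X = "prod_topology (subtopology E U) (Par E)"
  show ?thesis
  proof (rule pasting_lemma[where I = U and T = "\<lambda>x. N x \<times> topspace (Par E)" and f = "\<lambda>x z. f (fst z) (snd z)"])
    show "openin ?X (N x \<times> topspace (Par E))" if "x \<in> U" for x
      using N[OF that] U by (simp add: openin_prod_Times_iff openin_open_subtopology)
    show "continuous_map (subtopology ?X (N x \<times> topspace (Par E))) F (\<lambda>z. f (fst z) (snd z))" if "x \<in> U" for x
      using N[OF that] by (simp add: subtopology_Times subtopology_subtopology Int_absorb1)
    show "\<exists>j. j \<in> U \<and> z \<in> N j \<times> topspace (Par E) \<and> f (fst z) (snd z) = f (fst z) (snd z)" if "z \<in> topspace ?X" for z
      using that N by (intro exI[of _ "fst z"]) (auto simp only: topspace_prod_topology mem_Times_iff topspace_subtopology)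
  qed auto
qed

lemma par_deriv_eq:
  assumes "lc_space F" "has_dir_deriv F (\<lambda>z. f z (\<lambda>i. p (Suc i))) x (p 0) l"
  shows "par_deriv F f x p = l"
  unfolding par_deriv_def by (rule has_dir_deriv_eq[OF assms])

lemma par_deriv_cong:
  assumes "lc_space E" "openin E U" "\<And>x p. x \<in> U \<Longrightarrow> p \<in> topspace (Par E) \<Longrightarrow> f x p = g x p"
    and "x \<in> U" "p \<in> topspace (Par E)"
  shows "par_deriv F f x p = par_deriv F g x p"
  unfolding par_deriv_def
  by (rule dir_deriv_cong[OF assms(1,2,4)]) (use assms(3,5) Par_Suc in \<open>auto simp: Par_iff\<close>)

section \<open>Closure properties of the classes with parameters\<close>

context
  fixes E :: "'a::real_vector topology" and U :: "'a set"
  assumes E: "lc_space E" and U: "openin E U"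
begin

lemma Ck_par_SucE:
  assumes "Ck_par E F U (Suc k) f" "x \<in> U" "p \<in> topspace (Par E)"
  shows "has_dir_deriv F (\<lambda>z. f z (\<lambda>i. p (Suc i))) x (p 0) (par_deriv F f x p)"
  using assms by simp

lemma Ck_par_cong:
  assumes "\<And>x p. x \<in> U \<Longrightarrow> p \<in> topspace (Par E) \<Longrightarrow> f x p = g x p" "Ck_par E F U k f"
  shows "Ck_par E F U k g"
  using assms
proof (induction k arbitrary: f g)
  case 0
  then show ?case
    using cont_on_cong[OF U, where f=f and g=g] by simp
next
  case (Suc k)
  have eq: "par_deriv F f x p = par_deriv F g x p" if "x \<in> U" "p \<in> topspace (Par E)" for x p
    using par_deriv_cong[OF E U Suc.prems(1) that] .
  show ?case
    unfolding Ck_par.simps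
  proof (intro conjI ballI)
    show "cont_on E F U g"
      using Suc.prems(2) by (intro cont_on_cong[OF U Suc.prems(1)]) auto
    show "Ck_par E F U k (par_deriv F g)"
      using Suc.prems(2) eq by (intro Suc.IH[where f="par_deriv F f" and g="par_deriv F g"]) auto
  next
    fix x p assume xp: "x \<in> U" "p \<in> topspace (Par E)"
    then have "has_dir_deriv F (\<lambda>z. f z (\<lambda>i. p (Suc i))) x (p 0) (par_deriv F g x p)"
      using Ck_par_SucE[OF Suc.prems(2) xp] eq[OF xp] by simp
    moreover have p0: "p 0 \<in> topspace E"
      using xp by (simp add: Par_iff)
    moreover have eq': "f z (\<lambda>i. p (Suc i)) = g z (\<lambda>i. p (Suc i))" if "z \<in> U" for z
      using Suc.prems(1)[OF that Par_Suc[OF xp(2)]] .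
    ultimately show "has_dir_deriv F (\<lambda>z. g z (\<lambda>i. p (Suc i))) x (p 0) (par_deriv F g x p)"
      by (simp only: has_dir_deriv_cong[OF E U xp(1) p0 eq'])
  qed
qed

text \<open>Lets an explicit formula \<open>g\<close> stand in for the derivative picked by the
  description operator. Each closure property below exhibits such a formula and applies the
  induction hypothesis to it.\<close>

lemma Ck_par_SucI:
  assumes F: "lc_space F" and "cont_on E F U f" "Ck_par E F U k g"
    and d: "\<And>x p. x \<in> U \<Longrightarrow> p \<in> topspace (Par E) \<Longrightarrow>
      has_dir_deriv F (\<lambda>z. f z (\<lambda>i. p (Suc i))) x (p 0) (g x p)"
  shows "Ck_par E F U (Suc k) f"
proof -
  have eq: "g x p = par_deriv F f x p" if "x \<in> U" "p \<in> topspace (Par E)" for x p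
    using par_deriv_eq[OF F, where f=f and p=p, OF d[OF that]] by simp
  show ?thesis
    using Ck_par_cong[where f=g and g="par_deriv F f", OF eq assms(3)] assms(2) d eq by simp
qed

lemma Ck_par_subset:
  assumes "Ck_par E F U k f" "N \<subseteq> U"
  shows "Ck_par E F N k f"
  using assms(1) cont_on_subset[OF assms(2)]
  by (induction k arbitrary: f) (use assms(2) in auto)

lemma Ck_par_local:
  assumes "\<And>x. x \<in> U \<Longrightarrow> \<exists>N. openin E N \<and> x \<in> N \<and> N \<subseteq> U \<and> Ck_par E F N k f"
  shows "Ck_par E F U k f"
  using assms
proof (induction k arbitrary: f)
  case 0
  show ?case
    unfolding Ck_par.simps by (rule cont_on_local[OF U]) (use 0 in simp)
next
  case (Suc k)
  obtain N where N: "\<And>x. x \<in> U \<Longrightarrow> openin E (N x) \<and> x \<in> N x \<and> N x \<subseteq> U \<and> Ck_par E F (N x) (Suc k) f"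
    using Suc.prems by metis
  show ?case
    unfolding Ck_par.simps
  proof (intro conjI ballI)
    show "cont_on E F U f"
    proof (rule cont_on_local[OF U])
      show "\<exists>M. openin E M \<and> x \<in> M \<and> M \<subseteq> U \<and> cont_on E F M f" if "x \<in> U" for x
        using N[OF that] by (intro exI[of _ "N x"]) simp
    qed
    show "Ck_par E F U k (par_deriv F f)"
    proof (rule Suc.IH)
      show "\<exists>M. openin E M \<and> x \<in> M \<and> M \<subseteq> U \<and> Ck_par E F M k (par_deriv F f)" if "x \<in> U" for x
        using N[OF that] by (intro exI[of _ "N x"]) simp
    qed
    show "has_dir_deriv F (\<lambda>z. f z (\<lambda>i. p (Suc i))) x (p 0) (par_deriv F f x p)"
      if "x \<in> U" "p \<in> topspace (Par E)" for x p
      using N[OF that(1)] that(2) by simp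
  qed
qed

lemma cont_on_reindex:
  assumes "cont_on E F U f"
  shows "cont_on E F U (\<lambda>x p. f x (\<lambda>i. p (\<sigma> i)))"
proof -
  have "continuous_map (prod_topology (subtopology E U) (Par E)) (prod_topology (subtopology E U) (Par E))
      (\<lambda>z. (fst z, \<lambda>i. snd z (\<sigma> i)))"
    by (intro continuous_map_pairedI continuous_map_fst)
      (auto simp: continuous_map_Par intro: continuous_map_Par_component_of continuous_map_snd)
  from continuous_map_compose[OF this assms] show ?thesis
    by (simp add: o_def)
qed

text \<open>In the product and chain rules, the factors that are not differentiated see only the
  tail of \<open>p\<close>. The case \<sigma> = \<open>Suc\<close> keeps such factors in the
  class.\<close>

lemma Ck_par_reindex:
  assumes F: "lc_space F" and "Ck_par E F U k f"
  shows "Ck_par E F U k (\<lambda>x p. f x (\<lambda>i. p (\<sigma> i)))"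
  using assms(2)
proof (induction k arbitrary: f \<sigma>)
  case 0
  then show ?case
    using cont_on_reindex by simp
next
  case (Suc k)
  \<comment> \<open>The new direction stays at position 0; \<sigma> acts on the tail behind
    it.\<close>
  define \<sigma>' where "\<sigma>' = case_nat 0 (\<lambda>i. Suc (\<sigma> i))"
  show ?case
  proof (rule Ck_par_SucI[OF F])
    show "cont_on E F U (\<lambda>x p. f x (\<lambda>i. p (\<sigma> i)))"
      by (rule cont_on_reindex[OF Ck_par_cont[OF Suc.prems]])
    show "Ck_par E F U k (\<lambda>x p. par_deriv F f x (\<lambda>i. p (\<sigma>' i)))"
      using Suc.IH[of "par_deriv F f" \<sigma>'] Suc.prems by simp
    fix x p assume xp: "x \<in> U" "p \<in> topspace (Par E)"
    then have "(\<lambda>i. p (\<sigma>' i)) \<in> topspace (Par E)"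
      by (simp add: Par_iff)
    from Ck_par_SucE[OF Suc.prems xp(1) this] show "has_dir_deriv F (\<lambda>z. f z (\<lambda>i. p (Suc (\<sigma> i)))) x (p 0) (par_deriv F f x (\<lambda>i. p (\<sigma>' i)))"
      by (simp add: \<sigma>'_def)
  qed
qed

lemma Ck_par_const:
  assumes F: "lc_space F" and "c \<in> topspace F"
  shows "Ck_par E F U k (\<lambda>x p. c)"
  using assms(2)
proof (induction k arbitrary: c)
  case (Suc k)
  show ?case
    by (rule Ck_par_SucI[OF F _ Suc.IH[OF lc_zero[OF F]]])
      (use Suc.prems has_dir_deriv_const[OF F] in auto)
qed simp

lemma cont_on_fst: "cont_on E E U (\<lambda>x p. x)"
  by (rule continuous_map_into_fulltopology[OF continuous_map_fst])

text \<open>The derivative of the identity is the direction, that is the parameter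
  \<open>p 0\<close>. So the coordinates of \<open>p\<close> have to belong to the class; as
  functions of \<open>x\<close> they are constant.\<close>

lemma Ck_par_param: "Ck_par E E U k (\<lambda>x p. p i)"
proof -
  have c: "cont_on E E U (\<lambda>x p. p i)"
    by (rule continuous_map_Par_component_of[OF continuous_map_snd])
  show ?thesis
  proof (cases k)
    case (Suc j)
    show ?thesis
      unfolding Suc
      by (rule Ck_par_SucI[OF E c Ck_par_const[OF E lc_zero[OF E]]]) (rule has_dir_deriv_const[OF E])
  qed (use c in simp)
qed

lemma Ck_par_id: "Ck_par E E U k (\<lambda>x p. x)"
proof (cases k)
  case (Suc j)
  show ?thesis
    unfolding Suc
    by (rule Ck_par_SucI[OF E cont_on_fst Ck_par_param]) (auto intro: has_dir_deriv_id simp: Par_iff)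
qed (use cont_on_fst in simp)

lemma Ck_par_linear:
  assumes F: "lc_space F" and H: "lc_space H"
    and L: "linear_between F H L" "continuous_map F H L" and "Ck_par E F U k f"
  shows "Ck_par E H U k (\<lambda>x p. L (f x p))"
  using assms(5)
proof (induction k arbitrary: f)
  case 0
  then show ?case
    using continuous_map_compose[OF _ L(2)] by (auto simp: o_def)
next
  case (Suc k)
  show ?case
  proof (rule Ck_par_SucI[OF H])
    show "cont_on E H U (\<lambda>x p. L (f x p))"
      using continuous_map_compose[OF Ck_par_cont[OF Suc.prems] L(2)] by (simp add: o_def)
    show "Ck_par E H U k (\<lambda>x p. L (par_deriv F f x p))"
      using Suc.prems by (intro Suc.IH) simp
    fix x p assume xp: "x \<in> U" "p \<in> topspace (Par E)"
    show "has_dir_deriv H (\<lambda>z. L (f z (\<lambda>i. p (Suc i)))) x (p 0) (L (par_deriv F f x p))"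
      using Ck_par_SucE[OF Suc.prems xp] xp Ck_par_in[OF U Suc.prems _ Par_Suc[OF xp(2)]]
      by (intro has_dir_deriv_linear[OF F L E U]) (auto simp: Par_iff)
  qed
qed

lemma Ck_par_add:
  assumes F: "lc_space F" and "Ck_par E F U k f" "Ck_par E F U k g"
  shows "Ck_par E F U k (\<lambda>x p. f x p + g x p)"
  using assms(2,3)
proof (induction k arbitrary: f g)
  case 0
  then show ?case
    using lc_continuous_add[OF F, of _ "\<lambda>z. f (fst z) (snd z)" "\<lambda>z. g (fst z) (snd z)"] by simp
next
  case (Suc k)
  show ?case
  proof (rule Ck_par_SucI[OF F])
    show "cont_on E F U (\<lambda>x p. f x p + g x p)"
      by (rule lc_continuous_add[OF F Ck_par_cont[OF Suc.prems(1)] Ck_par_cont[OF Suc.prems(2)]])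
    show "Ck_par E F U k (\<lambda>x p. par_deriv F f x p + par_deriv F g x p)"
      using Suc.prems by (intro Suc.IH) auto
  qed (intro has_dir_deriv_add[OF F] Ck_par_SucE[OF Suc.prems(1)] Ck_par_SucE[OF Suc.prems(2)])
qed

lemma Ck_par_sum:
  assumes F: "lc_space F" and "\<And>i. i \<in> S \<Longrightarrow> Ck_par E F U k (f i)"
  shows "Ck_par E F U k (\<lambda>x p. \<Sum>i\<in>S. f i x p)"
  using assms(2)
  by (induction S rule: infinite_finite_induct)
    (auto intro!: Ck_par_const[OF F] Ck_par_add[OF F] lc_zero[OF F])

lemma Ck_par_scaleR:
  assumes F: "lc_space F" and "Ck_par E euclideanreal U k s" "Ck_par E F U k f"
  shows "Ck_par E F U k (\<lambda>x p. s x p *\<^sub>R f x p)"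
  using assms(2,3)
proof (induction k arbitrary: s f)
  case 0
  then show ?case
    using lc_continuous_scaleR[OF F, of _ "\<lambda>z. s (fst z) (snd z)" "\<lambda>z. f (fst z) (snd z)"] by simp
next
  case (Suc k)
  show ?case
  proof (rule Ck_par_SucI[OF F])
    show "cont_on E F U (\<lambda>x p. s x p *\<^sub>R f x p)"
      by (rule lc_continuous_scaleR[OF F Ck_par_cont[OF Suc.prems(1)] Ck_par_cont[OF Suc.prems(2)]])
    show "Ck_par E F U k (\<lambda>x p. par_deriv euclideanreal s x p *\<^sub>R f x (\<lambda>i. p (Suc i))
        + s x (\<lambda>i. p (Suc i)) *\<^sub>R par_deriv F f x p)"
      using Suc.prems
      by (intro Ck_par_add[OF F] Suc.IH Ck_par_reindex[OF F Ck_par_D[OF Suc.prems(2)]]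
          Ck_par_reindex[OF lc_space_euclideanreal Ck_par_D[OF Suc.prems(1)]]) auto
  next
    fix x p assume xp: "x \<in> U" "p \<in> topspace (Par E)"
    then show "has_dir_deriv F (\<lambda>z. s z (\<lambda>i. p (Suc i)) *\<^sub>R f z (\<lambda>i. p (Suc i))) x (p 0)
       (par_deriv euclideanreal s x p *\<^sub>R f x (\<lambda>i. p (Suc i)) + s x (\<lambda>i. p (Suc i)) *\<^sub>R par_deriv F f x p)"
      by (intro has_dir_deriv_scaleR[OF F] Ck_par_SucE[OF Suc.prems(1)] Ck_par_SucE[OF Suc.prems(2)] Suc.prems Ck_par_in[OF U Suc.prems(2)] Par_Suc)
  qed
qed

lemma Ck_par_diff:
  assumes F: "lc_space F" and "Ck_par E F U k f" "Ck_par E F U k g"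
  shows "Ck_par E F U k (\<lambda>x p. f x p - g x p)"
proof -
  have "Ck_par E F U k (\<lambda>x p. f x p + (-1) *\<^sub>R g x p)"
    by (intro Ck_par_add[OF F] Ck_par_scaleR[OF F] Ck_par_const[OF lc_space_euclideanreal] assms) simp
  then show ?thesis by simp
qed

lemma Ck_par_pair:
  assumes F: "lc_space F" and H: "lc_space H" and "Ck_par E F U k f" "Ck_par E H U k g"
  shows "Ck_par E (prod_topology F H) U k (\<lambda>x p. (f x p, g x p))"
  using assms(3,4)
proof (induction k arbitrary: f g)
  case (Suc k)
  show ?case
  proof (rule Ck_par_SucI[OF lc_space_prod[OF F H]])
    show "cont_on E (prod_topology F H) U (\<lambda>x p. (f x p, g x p))"
      using Suc.prems by (intro continuous_map_pairedI) auto
    show "Ck_par E (prod_topology F H) U k (\<lambda>x p. (par_deriv F f x p, par_deriv H g x p))"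
      using Suc.prems by (intro Suc.IH) auto
  qed (use Suc.prems Ck_par_SucE in \<open>auto simp: has_dir_deriv_pair\<close>)
qed (simp add: continuous_map_pairedI)

lemma Ck_par_power:
  assumes F: "lc_space F" and "\<And>i. i \<in> I \<Longrightarrow> Ck_par E F U k (\<lambda>x p. f x p i)"
    and "\<And>x p i. i \<notin> I \<Longrightarrow> f x p i = 0"
  shows "Ck_par E (lc_power F I) U k f"
  using assms(2,3)
proof (induction k arbitrary: f)
  case 0
  then show ?case
    by (simp add: continuous_map_lc_power[OF lc_zero[OF F]])
next
  case (Suc k)
  \<comment> \<open>The value 0 off \<open>I\<close> keeps the derivative inside the carrier of the
    power.\<close>
  define g where "g x p i = (if i \<in> I then par_deriv F (\<lambda>x p. f x p i) x p else 0)" for x p i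
  have c: "cont_on E (lc_power F I) U f"
    using Suc.prems by (simp add: continuous_map_lc_power[OF lc_zero[OF F]])
  show ?case
  proof (rule Ck_par_SucI[OF lc_space_power[OF F] c])
    show "Ck_par E (lc_power F I) U k g"
      using Suc.prems(1) by (intro Suc.IH) (auto simp: g_def)
    fix x p assume xp: "x \<in> U" "p \<in> topspace (Par E)"
    show "has_dir_deriv (lc_power F I) (\<lambda>z. f z (\<lambda>i. p (Suc i))) x (p 0) (g x p)"
    proof (rule has_dir_deriv_power[OF F E U xp(1)])
      show "p 0 \<in> topspace E"
        using xp by (simp add: Par_iff)
      show "f z (\<lambda>i. p (Suc i)) \<in> topspace (lc_power F I)" if "z \<in> U" for z
        using cont_on_in[OF U c that Par_Suc[OF xp(2)]] .
      show "g x p i = 0" if "i \<notin> I" for i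
        using that by (simp add: g_def)
      show "has_dir_deriv F (\<lambda>z. f z (\<lambda>i. p (Suc i)) i) x (p 0) (g x p i)" if "i \<in> I" for i
        using Ck_par_SucE[OF Suc.prems(1)[OF that] xp] that by (simp add: g_def)
    qed
  qed
qed

text \<open>A set \<open>S\<close> closed under differentiation replaces a class of smooth
  functions: the derivative of g(s) is g'(s) times the derivative of s, and the induction continues
  with g' in \<open>S\<close>.\<close>

lemma Ck_par_real_compose:
  assumes S: "\<And>g. g \<in> S \<Longrightarrow> \<exists>g'\<in>S. \<forall>x. (g has_real_derivative g' x) (at x)"
    and "g \<in> S" "Ck_par E euclideanreal U k s"
  shows "Ck_par E euclideanreal U k (\<lambda>x p. g (s x p))"
proof -
  have c: "cont_on E euclideanreal U (\<lambda>x p. g (s x p))" if g: "g \<in> S" and s: "cont_on E euclideanreal U s" for g s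
  proof -
    obtain g' where g': "\<And>x. (g has_real_derivative g' x) (at x)"
      using S[OF g] by blast
    have "isCont g x" for x
      using g'[of x] by (rule DERIV_isCont)
    then have "continuous_map euclideanreal euclideanreal g"
      by (simp add: continuous_at_imp_continuous_on)
    from continuous_map_compose[OF s this] show ?thesis
      by (simp add: o_def)
  qed
  from assms(2,3) show ?thesis
  proof (induction k arbitrary: g s)
    case 0
    then show ?case
      using c by simp
  next
    case (Suc k)
    note R = lc_space_euclideanreal
    obtain g' where g': "g' \<in> S" "\<And>x. (g has_real_derivative g' x) (at x)"
      using S[OF Suc.prems(1)] by blast
    show ?case
    proof (rule Ck_par_SucI[OF R c[OF Suc.prems(1) Ck_par_cont[OF Suc.prems(2)]]])
      show "Ck_par E euclideanreal U k (\<lambda>x p. g' (s x (\<lambda>i. p (Suc i))) *\<^sub>R par_deriv euclideanreal s x p)"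
        by (rule Ck_par_scaleR[OF R Suc.IH[OF g'(1) Ck_par_reindex[OF R Ck_par_D[OF Suc.prems(2)]]]])
          (use Suc.prems(2) in simp)
      fix x p assume xp: "x \<in> U" "p \<in> topspace (Par E)"
      \<comment> \<open>Restricting \<open>s\<close> to the line through \<open>x\<close> in
        direction \<open>p 0\<close> reduces the claim to the chain rule in one variable.\<close>
      define c where "c t = s (x + t *\<^sub>R p 0) (\<lambda>i. p (Suc i))" for t
      have "(c has_real_derivative par_deriv euclideanreal s x p) (at 0)"
        using Ck_par_SucE[OF Suc.prems(2) xp] by (simp add: has_dir_deriv_def DERIV_def c_def)
      from DERIV_chain2[OF g'(2) this]
      show "has_dir_deriv euclideanreal (\<lambda>z. g (s z (\<lambda>i. p (Suc i)))) x (p 0)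
          (g' (s x (\<lambda>i. p (Suc i))) *\<^sub>R par_deriv euclideanreal s x p)"
        by (simp add: has_dir_deriv_def DERIV_def c_def)
    qed
  qed
qed

end

section \<open>Comparison with iterated directional derivatives\<close>

lemma iter_deriv_snoc: "iter_deriv F f (ys @ [y]) x = dir_deriv F (iter_deriv F f ys) x y"
proof (induction ys arbitrary: f)
  case Nil
  have "iter_deriv F f [] = f"
    by (rule ext) simp
  then show ?case by simp
next
  case (Cons a ys)
  have "iter_deriv F f (a # ys) = iter_deriv F (\<lambda>z. dir_deriv F f z a) ys"
    by (rule ext) simp
  with Cons show ?case by simp
qed

text \<open>Each differentiation puts its direction in front, so the direction used first ends up at
  position \<open>k - 1\<close>. Hence the reversal.\<close>

lemma par_deriv_funpow:
  "(par_deriv F ^^ k) (\<lambda>x p. f x) = (\<lambda>x p. iter_deriv F f (map p (rev [0..<k])) x)"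
proof (induction k)
  case (Suc k)
  have "rev [0..<Suc k] = map Suc (rev [0..<k]) @ [0]"
    by (simp add: upt_conv_Cons rev_map del: upt_Suc flip: map_Suc_upt)
  then have "map p (rev [0..<Suc k]) = map (\<lambda>i. p (Suc i)) (rev [0..<k]) @ [p 0]" for p :: "nat \<Rightarrow> 'a"
    by simp
  then have "iter_deriv F f (map p (rev [0..<Suc k])) x
      = dir_deriv F (iter_deriv F f (map (\<lambda>i. p (Suc i)) (rev [0..<k]))) x (p 0)" for x p
    by (simp only: iter_deriv_snoc)
  then show ?case
    using Suc by (simp add: par_deriv_def del: upt_Suc)
qed simp

lemma Ck_par_iff_funpow:
  "Ck_par E F U k g \<longleftrightarrow> (\<forall>j\<le>k. cont_on E F U ((par_deriv F ^^ j) g)) \<and>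
     (\<forall>j<k. \<forall>x\<in>U. \<forall>p\<in>topspace (Par E).
        has_dir_deriv F (\<lambda>z. (par_deriv F ^^ j) g z (\<lambda>i. p (Suc i))) x (p 0) ((par_deriv F ^^ Suc j) g x p))"
proof (induction k arbitrary: g)
  case (Suc k)
  have *: "(\<forall>j\<le>Suc k. P j) \<longleftrightarrow> P 0 \<and> (\<forall>j\<le>k. P (Suc j))" for P
    by (metis Suc_le_mono not0_implies_Suc zero_le)
  show ?case
    unfolding Ck_par.simps Suc * All_less_Suc2
    by (simp add: funpow_swap1) blast
qed simp

lemma Ck_par_funpow:
  assumes "Ck_par E F U k g" "j + n \<le> k"
  shows "Ck_par E F U n ((par_deriv F ^^ j) g)"
  using assms
proof (induction j arbitrary: g k)
  case 0
  then show ?case using Ck_par_mono by simp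
next
  case (Suc j)
  then obtain k' where "k = Suc k'" "j + n \<le> k'"
    by (cases k) auto
  then show ?case
    using Suc.IH[of k' "par_deriv F g"] Suc.prems(1) by (simp add: funpow_swap1)
qed

text \<open>Sequences of directions and families indexed by \<open>{..<k}\<close> are converted into
  each other by continuous maps: reverse and fill up with 0 one way, reverse and truncate the other
  way.\<close>

lemma cont_on_iter_deriv:
  assumes E: "lc_space E"
  shows "cont_on E F U (\<lambda>x p. iter_deriv F f (map p (rev [0..<k])) x) \<longleftrightarrow>
    continuous_map (prod_topology (subtopology E U) (product_topology (\<lambda>_. E) {..<k})) F
      (\<lambda>(x, y). iter_deriv F f (map y [0..<k]) x)" (is "?L \<longleftrightarrow> ?R")
proof
  let ?X = "prod_topology (subtopology E U) (Par E)"
  let ?Y = "prod_topology (subtopology E U) (product_topology (\<lambda>_. E) {..<k})"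
  {
    assume ?L
    \<comment> \<open>The index \<open>k - Suc i\<close> performs the reversal; the filler 0 lies in
      the carrier.\<close>
    have m: "map (\<lambda>i. if i < k then y (k - Suc i) else 0) (rev [0..<k]) = map y [0..<k]" for y :: "nat \<Rightarrow> 'a"
      by (rule nth_equalityI) (auto simp: rev_nth)
    have "continuous_map ?Y E (\<lambda>z. if i < k then snd z (k - Suc i) else 0)" for i
    proof (cases "i < k")
      case True
      have "continuous_map (product_topology (\<lambda>_. E) {..<k}) E (\<lambda>y. y (k - Suc i))"
        using True by (intro continuous_map_product_projection) auto
      from continuous_map_compose[OF continuous_map_snd this] True show ?thesis
        by (simp add: o_def)
    qed (use lc_zero[OF E] in simp)
    then have "continuous_map ?Y ?X (\<lambda>z. (fst z, \<lambda>i. if i < k then snd z (k - Suc i) else 0))"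
      by (intro continuous_map_pairedI continuous_map_fst) (simp add: continuous_map_Par)
    from continuous_map_compose[OF this \<open>?L\<close>] show ?R
      by (simp only: o_def fst_conv snd_conv m case_prod_unfold)
  next
    assume ?R
    have m: "map (restrict (\<lambda>i. p (k - Suc i)) {..<k}) [0..<k] = map p (rev [0..<k])" for p :: "nat \<Rightarrow> 'a"
      by (rule nth_equalityI) (auto simp: rev_nth)
    have "continuous_map ?X (product_topology (\<lambda>_. E) {..<k}) (\<lambda>z. restrict (\<lambda>i. snd z (k - Suc i)) {..<k})"
      unfolding continuous_map_componentwise
      by (auto intro: continuous_map_Par_component_of[OF continuous_map_snd])
    then have "continuous_map ?X ?Y (\<lambda>z. (fst z, restrict (\<lambda>i. snd z (k - Suc i)) {..<k}))"
      by (intro continuous_map_pairedI continuous_map_fst)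
    from continuous_map_compose[OF this \<open>?R\<close>] show ?L
      by (simp only: o_def fst_conv snd_conv m case_prod_unfold)
  }
qed

text \<open>Carries every closure property of \<open>Ck_par\<close> over to \<open>Cr_on\<close>.
  Limits in the Hausdorff space \<open>F\<close> are unique, so a directional derivative that merely
  exists equals the value named by \<open>par_deriv\<close>.\<close>

theorem Cr_on_iff_Ck_par:
  assumes E: "lc_space E" and F: "lc_space F"
  shows "Cr_on r E F U f \<longleftrightarrow> openin E U \<and> (\<forall>k. enat k \<le> r \<longrightarrow> Ck_par E F U k (\<lambda>x p. f x))"
proof
  assume f: "Cr_on r E F U f"
  have "Ck_par E F U k (\<lambda>x p. f x)" if k: "enat k \<le> r" for k
    unfolding Ck_par_iff_funpow
  proof (intro conjI allI impI ballI)
    fix j assume "j \<le> k"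
    then have "enat j \<le> r"
      using k order_trans[of "enat j" "enat k" r] by simp
    then show "cont_on E F U ((par_deriv F ^^ j) (\<lambda>x p. f x))"
      using f unfolding par_deriv_funpow cont_on_iter_deriv[OF E] Cr_on_def by blast
  next
    fix j x p assume jxp: "j < k" "x \<in> U" "p \<in> topspace (Par E)"
    define ys where "ys = map (\<lambda>i. p (Suc i)) (rev [0..<j])"
    have "enat (Suc (length ys)) \<le> r"
      using k jxp(1) order_trans[of "enat (Suc j)" "enat k" r] by (simp add: ys_def)
    moreover have "ys \<in> lists (topspace E)" "p 0 \<in> topspace E"
      using jxp(3) by (auto simp: ys_def Par_iff)
    ultimately obtain l where l: "has_dir_deriv F (iter_deriv F f ys) x (p 0) l"
      using f jxp(2) unfolding Cr_on_def by blast
    then have "has_dir_deriv F (\<lambda>z. (par_deriv F ^^ j) (\<lambda>x p. f x) z (\<lambda>i. p (Suc i))) x (p 0) l"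
      by (simp only: par_deriv_funpow ys_def)
    moreover from par_deriv_eq[OF F, where f="(par_deriv F ^^ j) (\<lambda>x p. f x)" and p=p, OF this] have "(par_deriv F ^^ Suc j) (\<lambda>x p. f x) x p = l"
      by simp
    ultimately show "has_dir_deriv F (\<lambda>z. (par_deriv F ^^ j) (\<lambda>x p. f x) z (\<lambda>i. p (Suc i))) x (p 0)
        ((par_deriv F ^^ Suc j) (\<lambda>x p. f x) x p)"
      by simp
  qed
  with f show "openin E U \<and> (\<forall>k. enat k \<le> r \<longrightarrow> Ck_par E F U k (\<lambda>x p. f x))"
    by (simp add: Cr_on_def)
next
  assume f: "openin E U \<and> (\<forall>k. enat k \<le> r \<longrightarrow> Ck_par E F U k (\<lambda>x p. f x))"
  show "Cr_on r E F U f"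
    unfolding Cr_on_def
  proof (intro conjI ballI allI impI)
    fix k assume "enat k \<le> r"
    then have "cont_on E F U ((par_deriv F ^^ k) (\<lambda>x p. f x))"
      using f unfolding Ck_par_iff_funpow by blast
    then show "continuous_map (prod_topology (subtopology E U) (product_topology (\<lambda>_. E) {..<k})) F
      (\<lambda>(x, y). iter_deriv F f (map y [0..<k]) x)"
      unfolding par_deriv_funpow cont_on_iter_deriv[OF E] .
  next
    fix x ys y assume *: "x \<in> U" "ys \<in> lists (topspace E)" "y \<in> topspace E" "enat (Suc (length ys)) \<le> r"
    \<comment> \<open>\<open>y\<close> is the direction used last, so it comes first; the list
      follows in reverse, padded by 0.\<close>
    define p where "p = case_nat y (\<lambda>i. if i < length ys then rev ys ! i else 0)"
    have ys: "map (\<lambda>i. p (Suc i)) (rev [0..<length ys]) = ys"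
      by (rule nth_equalityI) (auto simp: p_def rev_nth)
    have "p i \<in> topspace E" for i
    proof (cases i)
      case (Suc j)
      have "rev ys ! j \<in> set ys" if "j < length ys"
        using that nth_mem[of j "rev ys"] by simp
      then show ?thesis
        using *(2) lc_zero[OF E] by (auto simp: p_def Suc)
    qed (use * in \<open>simp add: p_def\<close>)
    then have "p \<in> topspace (Par E)"
      by (simp add: Par_iff)
    then have "has_dir_deriv F (\<lambda>z. (par_deriv F ^^ length ys) (\<lambda>x p. f x) z (\<lambda>i. p (Suc i))) x (p 0)
        ((par_deriv F ^^ Suc (length ys)) (\<lambda>x p. f x) x p)"
      using f *(1,4) unfolding Ck_par_iff_funpow by blast
    then have "has_dir_deriv F (iter_deriv F f ys) x y ((par_deriv F ^^ Suc (length ys)) (\<lambda>x p. f x) x p)"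
      unfolding par_deriv_funpow ys by (simp add: p_def)
    then show "\<exists>l. has_dir_deriv F (iter_deriv F f ys) x y l" ..
  qed (use f in blast)
qed

section \<open>The chain rule\<close>

lemma case_nat_Par: "a \<in> topspace E \<Longrightarrow> p \<in> topspace (Par E) \<Longrightarrow> case_nat a p \<in> topspace (Par E)"
  by (auto simp: Par_iff split: nat.split)

lemma fun_upd_Par: "a \<in> topspace E \<Longrightarrow> p \<in> topspace (Par E) \<Longrightarrow> p(i := a) \<in> topspace (Par E)"
  by (auto simp: Par_iff)

lemma limitin_Par:
  "limitin (Par E) f l G \<longleftrightarrow>
    eventually (\<lambda>t. f t \<in> topspace (Par E)) G \<and> (\<forall>i. limitin E (\<lambda>t. f t i) (l i) G)"
  by (simp add: Par_def limitin_componentwise)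

text \<open>\<open>G m u q\<close> is the m-th derivative of \<open>g\<close> at \<open>u\<close> in
  the directions q(m-1), ..., q(0), taken in this order. Terms of this shape, with \<open>u\<close>
  and \<open>q\<close> depending on a further point, are what iterated differentiation of a
  composition produces.\<close>

locale param_Cr_map =
  fixes F :: "'b::real_vector topology" and H :: "'c::real_vector topology"
    and V :: "'b set" and g :: "'b \<Rightarrow> 'c" and N :: nat and G
  assumes F: "lc_space F" and H: "lc_space H" and V: "openin F V"
    and g: "Ck_par F H V N (\<lambda>u q. g u)"
  defines "G m \<equiv> (par_deriv H ^^ m) (\<lambda>u q. g u)"
begin

lemma G_depends:
  assumes "\<And>i. i < m \<Longrightarrow> q i = q' i"
  shows "G m u q = G m u q'"
proof -
  have "map q (rev [0..<m]) = map q' (rev [0..<m])"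
    using assms by auto
  then show ?thesis
    by (simp only: G_def par_deriv_funpow)
qed

lemma G_Ck_par: "m + n \<le> N \<Longrightarrow> Ck_par F H V n (G m)"
  unfolding G_def by (rule Ck_par_funpow[OF g])

lemma G_cont: "m \<le> N \<Longrightarrow> cont_on F H V (G m)"
  using G_Ck_par[of m 0] by simp

lemma G_in: "m \<le> N \<Longrightarrow> u \<in> V \<Longrightarrow> q \<in> topspace (Par F) \<Longrightarrow> G m u q \<in> topspace H"
  by (rule cont_on_in[OF V G_cont])

lemma G_Suc_eq: "G (Suc m) = par_deriv H (G m)"
  by (simp add: G_def)

lemma G_deriv:
  assumes "m < N" "u \<in> V" "y \<in> topspace F" "q \<in> topspace (Par F)"
  shows "has_dir_deriv H (\<lambda>z. G m z q) u y (G (Suc m) u (case_nat y q))"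
proof -
  have "Ck_par F H V (Suc 0) (G m)"
    using G_Ck_par[of m "Suc 0"] assms(1) by simp
  from Ck_par_SucE[OF F V this assms(2) case_nat_Par[OF assms(3,4)]]
  show ?thesis
    by (simp add: G_Suc_eq)
qed

lemma G_deriv_cont:
  assumes "m < N" "q \<in> topspace (Par F)"
  shows "continuous_map (prod_topology (subtopology F V) F) H (\<lambda>(u, y). G (Suc m) u (case_nat y q))"
proof -
  let ?X = "prod_topology (subtopology F V) F"
  have "continuous_map ?X F (\<lambda>z. case_nat (snd z) q i)" for i
    using assms(2) by (cases i) (auto simp: Par_iff continuous_map_snd)
  then have "continuous_map ?X (prod_topology (subtopology F V) (Par F)) (\<lambda>z. (fst z, case_nat (snd z) q))"
    by (intro continuous_map_pairedI continuous_map_fst) (simp add: continuous_map_Par)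
  from continuous_map_compose[OF this G_cont[of "Suc m"]] assms(1) show ?thesis
    by (simp add: o_def case_prod_unfold)
qed

text \<open>The newest direction, at position 0, is the one in which a derivative is taken, so
  linearity there is linearity of derivatives. An older direction enters linearly into
  \<open>G m z\<close> for all \<open>z\<close> in \<open>V\<close> by induction, and
  differentiating these identities in \<open>z\<close> preserves them.\<close>

lemma G_linear:
  assumes "m \<le> N" "i < m" "u \<in> V" "q \<in> topspace (Par F)"
  shows "linear_between F H (\<lambda>w. G m u (q(i := w)))"
  using assms
proof (induction m arbitrary: i u q)
  case (Suc m)
  define q' where "q' = (\<lambda>i. q (Suc i))"
  have q': "q' \<in> topspace (Par F)"
    using Suc.prems(4) by (simp add: q'_def Par_iff)
  have m: "m < N" "m \<le> N"
    using Suc.prems by auto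
  show ?case
  proof (cases i)
    case 0
    have "q(0 := w) = case_nat w q'" for w
      by (auto simp: q'_def split: nat.split)
    then show ?thesis
      using lc_derivative_linear[OF F H V Suc.prems(3) G_deriv[OF m(1) _ _ q'] G_deriv_cont[OF m(1) q']]
      by (simp add: 0)
  next
    case i: (Suc j)
    have upd: "q(Suc j := w) = case_nat (q 0) (q'(j := w))" for w
      by (auto simp: q'_def split: nat.split)
    have q0: "q 0 \<in> topspace F"
      using Suc.prems(4) by (simp add: Par_iff)
    have IH: "linear_between F H (\<lambda>w. G m z (q'(j := w)))" if "z \<in> V" for z
      using Suc.prems i that q' by (intro Suc.IH) auto
    have d: "has_dir_deriv H (\<lambda>z. G m z (q'(j := w))) u (q 0) (G (Suc m) u (q(i := w)))"
      if "w \<in> topspace F" for w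
      using G_deriv[OF m(1) Suc.prems(3) q0 fun_upd_Par[OF that q']] by (simp add: i upd)
    show ?thesis
      unfolding linear_between_def
    proof (intro conjI ballI allI image_subsetI)
      show "G (Suc m) u (q(i := w)) \<in> topspace H" if "w \<in> topspace F" for w
        using G_in[OF Suc.prems(1,3) fun_upd_Par[OF that Suc.prems(4)]] .
      fix w assume w: "w \<in> topspace F"
      {
        fix w' assume w': "w' \<in> topspace F"
        have eq: "G m z (q'(j := w + w')) = G m z (q'(j := w)) + G m z (q'(j := w'))" if "z \<in> V" for z
          using IH[OF that] w w' by (simp add: linear_between_def)
        have "has_dir_deriv H (\<lambda>z. G m z (q'(j := w + w'))) u (q 0)
            (G (Suc m) u (q(i := w)) + G (Suc m) u (q(i := w')))"
          by (rule iffD2[OF has_dir_deriv_cong[OF F V Suc.prems(3) q0 eq] has_dir_deriv_add[OF H d[OF w] d[OF w']]])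
        then show "G (Suc m) u (q(i := w + w')) = G (Suc m) u (q(i := w)) + G (Suc m) u (q(i := w'))"
          using has_dir_deriv_eq[OF H] d[OF lc_add[OF F w w']] by metis
      }
      fix c :: real
      have eq: "G m z (q'(j := c *\<^sub>R w)) = c *\<^sub>R G m z (q'(j := w))" if "z \<in> V" for z
        using IH[OF that] w by (simp add: linear_between_def)
      \<comment> \<open>The scalar \<open>c\<close> is treated as a constant function, so the
        product rule contributes a term with factor 0.\<close>
      have "has_dir_deriv H (\<lambda>z. G m z (q'(j := c *\<^sub>R w))) u (q 0)
          (0 *\<^sub>R G m u (q'(j := w)) + c *\<^sub>R G (Suc m) u (q(i := w)))"
        by (rule iffD2[OF has_dir_deriv_cong[OF F V Suc.prems(3) q0 eq] has_dir_deriv_scaleR[OF H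
              G_in[OF m(2) Suc.prems(3) fun_upd_Par[OF w q']] has_dir_deriv_const[OF lc_space_euclideanreal] d[OF w]]])
      then show "G (Suc m) u (q(i := c *\<^sub>R w)) = c *\<^sub>R G (Suc m) u (q(i := w))"
        using has_dir_deriv_eq[OF H] d[OF lc_scaleR[OF F w, of c]] by (metis add_0 scale_zero_left)
    qed
  qed
qed simp

lemma G_limit:
  assumes "m \<le> N" "limitin F c u \<F>" "u \<in> V" "limitin (Par F) W q \<F>"
  shows "limitin H (\<lambda>t. G m (c t) (W t)) (G m u q) \<F>"
proof -
  have "eventually (\<lambda>t. c t \<in> V) \<F>"
    using assms(2,3) V by (simp add: limitin_def)
  then have "limitin (prod_topology (subtopology F V) (Par F)) (\<lambda>t. (c t, W t)) (u, q) \<F>"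
    using assms by (simp add: limitin_pairwise o_def limitin_subtopology)
  from continuous_map_limit[OF G_cont[OF assms(1)] this] show ?thesis
    by (simp add: o_def)
qed

text \<open>Multilinearity in the directions turns the increments of the directions, which are
  exchanged one after the other, into difference quotients.\<close>

lemma G_curve_derivative:
  assumes m: "m < N" and c: "c 0 \<in> V" "limitin F (\<lambda>t. (1 / t) *\<^sub>R (c t - c 0)) l (at 0)"
    and W0: "W 0 \<in> topspace (Par F)"
    and W: "eventually (\<lambda>t. W t \<in> topspace (Par F)) (at 0)"
    and W': "\<And>i. limitin F (\<lambda>t. (1 / t) *\<^sub>R (W t i - W 0 i)) (W' i) (at (0::real))"
  shows "limitin H (\<lambda>t. (1 / t) *\<^sub>R (G m (c t) (W t) - G m (c 0) (W 0)))
    (G (Suc m) (c 0) (case_nat l (W 0)) + (\<Sum>i<m. G m (c 0) ((W 0)(i := W' i)))) (at 0)"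
proof -
  have c0: "c 0 \<in> topspace F"
    using c V openin_subset by blast
  have c_lim: "limitin F c (c 0) (at 0)"
    by (rule lc_curve_continuous[OF F c0 c(2)])
  have W_lim: "limitin F (\<lambda>t. W t i) (W 0 i) (at 0)" for i
    using lc_curve_continuous[OF F _ W'] W0 by (simp add: Par_iff)
  have m': "m \<le> N" using m by simp
  \<comment> \<open>Hybrid directions: the first \<open>j\<close> entries are already those at time
    \<open>t\<close>, the others still those at time 0.\<close>
  define Z where "Z t j = (\<lambda>i. if i < j then W t i else W 0 i)" for t j
  have ev: "eventually (\<lambda>t. t \<noteq> 0 \<and> c t \<in> V \<and> W t \<in> topspace (Par F)) (at (0::real))"
    using W limitinD[OF c_lim V c(1)] by (simp add: eventually_conj_iff eventually_at_filter)
  have diffF: "(1 / t) *\<^sub>R (W t j - W 0 j) \<in> topspace F" if "W t \<in> topspace (Par F)" for t j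
    using that W0 by (intro lc_scaleR[OF F] lc_diff[OF F]) (auto simp: Par_iff)
  have ZP: "Z t j \<in> topspace (Par F)" if "W t \<in> topspace (Par F)" for t j
    using that W0 by (auto simp: Z_def Par_iff)
  \<comment> \<open>Two consecutive hybrids differ in entry \<open>j\<close> alone. Linearity in
    that entry moves the difference and the factor \<open>1 / t\<close> inside.\<close>
  have step: "(1 / t) *\<^sub>R (G m (c t) (Z t (Suc j)) - G m (c t) (Z t j))
      = G m (c t) ((Z t j)(j := (1 / t) *\<^sub>R (W t j - W 0 j)))"
    if j: "j < m" and t: "t \<noteq> 0 \<and> c t \<in> V \<and> W t \<in> topspace (Par F)" for j t
  proof -
    have lin: "linear_between F H (\<lambda>w. G m (c t) ((Z t j)(j := w)))"
      using G_linear[OF m' j _ ZP] t by simp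
    have in_F: "W t j \<in> topspace F" "W 0 j \<in> topspace F"
      using t W0 by (auto simp: Par_iff)
    have "G m (c t) ((Z t j)(j := (1 / t) *\<^sub>R (W t j - W 0 j)))
        = (1 / t) *\<^sub>R G m (c t) ((Z t j)(j := W t j - W 0 j))"
      using lin lc_diff[OF F in_F] by (simp add: linear_between_def)
    moreover have "G m (c t) ((Z t j)(j := W t j - W 0 j + W 0 j))
        = G m (c t) ((Z t j)(j := W t j - W 0 j)) + G m (c t) ((Z t j)(j := W 0 j))"
      using lin lc_diff[OF F in_F] in_F unfolding linear_between_def by blast
    moreover have "(Z t j)(j := W t j) = Z t (Suc j)" "(Z t j)(j := W 0 j) = Z t j"
      by (auto simp: Z_def)
    ultimately show ?thesis
      by simp
  qed
  \<comment> \<open>All entries except the j-th converge to those of \<open>W 0\<close>, whether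
    exchanged or not, so the limit does not depend on how far the exchange has got.\<close>
  have "limitin H (\<lambda>t. G m (c t) ((Z t j)(j := (1 / t) *\<^sub>R (W t j - W 0 j))))
      (G m (c 0) ((W 0)(j := W' j))) (at 0)" for j
  proof (rule G_limit[OF m' c_lim c(1)])
    have "eventually (\<lambda>t. (Z t j)(j := (1 / t) *\<^sub>R (W t j - W 0 j)) \<in> topspace (Par F)) (at 0)"
      using W by (rule eventually_mono) (intro fun_upd_Par ZP diffF)
    moreover have "limitin F (\<lambda>t. ((Z t j)(j := (1 / t) *\<^sub>R (W t j - W 0 j))) i) (((W 0)(j := W' j)) i) (at 0)" for i
      using W_lim W' W0 by (cases "i < j") (simp_all add: Z_def Par_iff)
    ultimately show "limitin (Par F) (\<lambda>t. (Z t j)(j := (1 / t) *\<^sub>R (W t j - W 0 j))) ((W 0)(j := W' j)) (at 0)"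
      unfolding limitin_Par by (intro conjI allI)
  qed
  then have "limitin H (\<lambda>t. \<Sum>j<m. G m (c t) ((Z t j)(j := (1 / t) *\<^sub>R (W t j - W 0 j))))
      (\<Sum>j<m. G m (c 0) ((W 0)(j := W' j))) (at 0)"
    by (intro lc_limitin_sum[OF H])
  \<comment> \<open>The base point moves while the directions are frozen at time 0; the directions
    are exchanged at the base point already moved to \<open>c t\<close>.\<close>
  moreover have "limitin H (\<lambda>t. (1 / t) *\<^sub>R (G m (c t) (W 0) - G m (c 0) (W 0)))
      (G (Suc m) (c 0) (case_nat l (W 0))) (at 0)"
    by (rule lc_curve_chain[OF F H V c(1) G_deriv[OF m _ _ W0] G_deriv_cont[OF m W0] c(2)])
  ultimately have "limitin H (\<lambda>t. (1 / t) *\<^sub>R (G m (c t) (W 0) - G m (c 0) (W 0))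
        + (\<Sum>j<m. G m (c t) ((Z t j)(j := (1 / t) *\<^sub>R (W t j - W 0 j)))))
      (G (Suc m) (c 0) (case_nat l (W 0)) + (\<Sum>i<m. G m (c 0) ((W 0)(i := W' i)))) (at 0)"
    by (intro lc_limitin_add[OF H])
  moreover have "eventually (\<lambda>t. (1 / t) *\<^sub>R (G m (c t) (W 0) - G m (c 0) (W 0))
        + (\<Sum>j<m. G m (c t) ((Z t j)(j := (1 / t) *\<^sub>R (W t j - W 0 j))))
      = (1 / t) *\<^sub>R (G m (c t) (W t) - G m (c 0) (W 0))) (at 0)"
    using ev
  proof (rule eventually_mono)
    fix t assume t: "t \<noteq> 0 \<and> c t \<in> V \<and> W t \<in> topspace (Par F)"
    \<comment> \<open>\<open>G m\<close> reads only the first \<open>m\<close> entries, so after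
      \<open>m\<close> exchanges the hybrid is as good as \<open>W t\<close>.\<close>
    have Z: "G m (c t) (Z t m) = G m (c t) (W t)" "Z t 0 = W 0"
      by (auto intro!: G_depends simp: Z_def)
    have "(\<Sum>j<m. G m (c t) ((Z t j)(j := (1 / t) *\<^sub>R (W t j - W 0 j))))
        = (\<Sum>j<m. (1 / t) *\<^sub>R (G m (c t) (Z t (Suc j)) - G m (c t) (Z t j)))"
      using step[OF _ t] by (intro sum.cong) auto
    also have "\<dots> = (1 / t) *\<^sub>R (G m (c t) (W t) - G m (c t) (W 0))"
      using sum_lessThan_telescope[of "\<lambda>j. G m (c t) (Z t j)" m] by (simp add: Z flip: scaleR_sum_right)
    finally have sum: "(\<Sum>j<m. G m (c t) ((Z t j)(j := (1 / t) *\<^sub>R (W t j - W 0 j))))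
        = (1 / t) *\<^sub>R (G m (c t) (W t) - G m (c t) (W 0))" .
    show "(1 / t) *\<^sub>R (G m (c t) (W 0) - G m (c 0) (W 0))
        + (\<Sum>j<m. G m (c t) ((Z t j)(j := (1 / t) *\<^sub>R (W t j - W 0 j))))
      = (1 / t) *\<^sub>R (G m (c t) (W t) - G m (c 0) (W 0))"
      unfolding sum by (simp flip: scaleR_add_right)
  qed
  ultimately show ?thesis
    by (rule limitin_transform_eventually[rotated])
qed

lemma cont_on_G_compose:
  assumes "openin E U" "m \<le> N" "cont_on E F U f" "\<And>i. cont_on E F U (\<lambda>x p. W x p i)"
    and "\<And>x p. x \<in> U \<Longrightarrow> p \<in> topspace (Par E) \<Longrightarrow> f x p \<in> V"
  shows "cont_on E H U (\<lambda>x p. G m (f x p) (W x p))"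
proof -
  let ?X = "prod_topology (subtopology E U) (Par E)"
  have "continuous_map ?X (subtopology F V) (\<lambda>z. f (fst z) (snd z))"
    using assms(3,5) by (auto simp: continuous_map_in_subtopology)
  moreover have "continuous_map ?X (Par F) (\<lambda>z. W (fst z) (snd z))"
    using assms(4) by (simp add: continuous_map_Par)
  ultimately have "continuous_map ?X (prod_topology (subtopology F V) (Par F))
      (\<lambda>z. (f (fst z) (snd z), W (fst z) (snd z)))"
    by (rule continuous_map_pairedI)
  from continuous_map_compose[OF this G_cont[OF assms(2)]] show ?thesis
    by (simp add: o_def)
qed

text \<open>Stated for every \<open>m\<close> and for moving directions \<open>W\<close>, since the
  derivative of g(f(x)) already contains \<open>G 1\<close> in a direction depending on x. The bound
  \<open>m + k \<le> N\<close> is the budget of the induction: a derivative of the composition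
  raises \<open>m\<close> by at most one while \<open>k\<close> drops by one.\<close>

lemma Ck_par_G_compose:
  fixes E :: "'a::real_vector topology"
  assumes E: "lc_space E" and U: "openin E U"
    and "m + k \<le> N" "Ck_par E F U k f" "\<And>i. Ck_par E F U k (\<lambda>x p. W x p i)"
    and "\<And>x p. x \<in> U \<Longrightarrow> p \<in> topspace (Par E) \<Longrightarrow> f x p \<in> V"
  shows "Ck_par E H U k (\<lambda>x p. G m (f x p) (W x p))"
  using assms(3-6)
proof (induction k arbitrary: m f W)
  case (0 m f W)
  then show ?case
    by (simp add: cont_on_G_compose[OF U])
next
  case (Suc k m f W)
  define tl :: "(nat \<Rightarrow> 'a) \<Rightarrow> nat \<Rightarrow> 'a" where "tl p = (\<lambda>i. p (Suc i))" for p
  define W' where "W' x p i = par_deriv F (\<lambda>x p. W x p i) x p" for x p i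
  note fD = Ck_par_reindex[OF E U F Ck_par_D[OF Suc.prems(2)], of Suc, folded tl_def]
  note WD = Ck_par_reindex[OF E U F Ck_par_D[OF Suc.prems(3)], of Suc, folded tl_def]
  have f': "Ck_par E F U k (par_deriv F f)"
    using Suc.prems(2) by simp
  have W': "Ck_par E F U k (\<lambda>x p. W' x p i)" for i
    using Suc.prems(3)[of i] by (simp add: W'_def)
  have tl: "tl p \<in> topspace (Par E)" if "p \<in> topspace (Par E)" for p
    using Par_Suc[OF that] by (simp add: tl_def)
  show ?case
  proof (rule Ck_par_SucI[OF E U H])
    show "cont_on E H U (\<lambda>x p. G m (f x p) (W x p))"
      using Suc.prems by (intro cont_on_G_compose[OF U] Ck_par_cont[OF Suc.prems(2)] Ck_par_cont[OF Suc.prems(3)]) auto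
    \<comment> \<open>Both kinds of summand have the shape covered by the induction hypothesis: one
      of order \<open>Suc m\<close> with the derivative of \<open>f\<close> as newest direction, and
      those of order \<open>m\<close> with one direction replaced by its derivative.\<close>
    have "Ck_par E H U k (\<lambda>x p. G (Suc m) (f x (tl p)) (case_nat (par_deriv F f x p) (W x (tl p))))"
    proof (rule Suc.IH[OF _ fD])
      show "Ck_par E F U k (\<lambda>x p. case_nat (par_deriv F f x p) (W x (tl p)) i)" for i
        using f' WD by (cases i) auto
    qed (use Suc.prems tl in auto)
    moreover have "Ck_par E H U k (\<lambda>x p. G m (f x (tl p)) ((W x (tl p))(i := W' x p i)))" for i
    proof (rule Suc.IH[OF _ fD])
      show "Ck_par E F U k (\<lambda>x p. ((W x (tl p))(i := W' x p i)) j)" for j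
        using W' WD by (cases "j = i") auto
    qed (use Suc.prems tl in auto)
    ultimately show "Ck_par E H U k (\<lambda>x p. G (Suc m) (f x (tl p)) (case_nat (par_deriv F f x p) (W x (tl p)))
        + (\<Sum>i<m. G m (f x (tl p)) ((W x (tl p))(i := W' x p i))))"
      by (intro Ck_par_add[OF E U H] Ck_par_sum[OF E U H])
  next
    fix x p assume xp: "x \<in> U" "p \<in> topspace (Par E)"
    define c where "c t = f (x + t *\<^sub>R p 0) (tl p)" for t
    define w where "w t = W (x + t *\<^sub>R p 0) (tl p)" for t
    have p0: "p 0 \<in> topspace E"
      using xp by (simp add: Par_iff)
    have w_in: "W z (tl p) \<in> topspace (Par F)" if "z \<in> U" for z
      using Ck_par_in[OF U Suc.prems(3) that tl[OF xp(2)]] by (simp add: Par_iff)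
    have "limitin H (\<lambda>t. (1 / t) *\<^sub>R (G m (c t) (w t) - G m (c 0) (w 0)))
      (G (Suc m) (c 0) (case_nat (par_deriv F f x p) (w 0)) + (\<Sum>i<m. G m (c 0) ((w 0)(i := W' x p i)))) (at 0)"
    proof (rule G_curve_derivative)
      show "m < N" using Suc.prems(1) by simp
      show "c 0 \<in> V" "w 0 \<in> topspace (Par F)"
        using Suc.prems(4)[OF xp(1) tl[OF xp(2)]] w_in[OF xp(1)] by (simp_all add: c_def w_def)
      show "limitin F (\<lambda>t. (1 / t) *\<^sub>R (c t - c 0)) (par_deriv F f x p) (at 0)"
        using Ck_par_SucE[OF E U Suc.prems(2) xp] by (simp add: has_dir_deriv_def c_def tl_def)
      show "limitin F (\<lambda>t. (1 / t) *\<^sub>R (w t i - w 0 i)) (W' x p i) (at 0)" for i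
        using Ck_par_SucE[OF E U Suc.prems(3)[of i] xp] by (simp add: has_dir_deriv_def w_def tl_def W'_def)
      show "eventually (\<lambda>t. w t \<in> topspace (Par F)) (at 0)"
        using lc_line_eventually[OF E U xp(1) p0] by (rule eventually_mono) (simp add: w_def w_in)
    qed
    then show "has_dir_deriv H (\<lambda>z. G m (f z (\<lambda>i. p (Suc i))) (W z (\<lambda>i. p (Suc i)))) x (p 0)
        (G (Suc m) (f x (tl p)) (case_nat (par_deriv F f x p) (W x (tl p)))
        + (\<Sum>i<m. G m (f x (tl p)) ((W x (tl p))(i := W' x p i))))"
      by (simp add: has_dir_deriv_def c_def w_def flip: tl_def)
  qed
qed

end

lemma Ck_par_compose:
  assumes E: "lc_space E" and F: "lc_space F" and H: "lc_space H" and U: "openin E U" and V: "openin F V"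
    and g: "Ck_par F H V k (\<lambda>u q. g u)" and f: "Ck_par E F U k f"
    and "\<And>x p. x \<in> U \<Longrightarrow> p \<in> topspace (Par E) \<Longrightarrow> f x p \<in> V"
  shows "Ck_par E H U k (\<lambda>x p. g (f x p))"
proof -
  interpret param_Cr_map F H V g k "\<lambda>m. (par_deriv H ^^ m) (\<lambda>u q. g u)"
    by unfold_locales (use F H V g in auto)
  \<comment> \<open>\<open>G 0\<close> is \<open>g\<close> itself and reads no directions, so the
    zero sequence serves as \<open>W\<close>.\<close>
  show ?thesis
    using Ck_par_G_compose[OF E U, of 0 k f "\<lambda>x p i. 0"] f assms(8) Ck_par_const[OF E U F lc_zero[OF F]]
    by simp
qed

theorem Cr_on_compose:
  assumes "lc_space E" "lc_space F" "lc_space H"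
    and "Cr_on r F H V g" "Cr_on r E F U f" "f ` U \<subseteq> V"
  shows "Cr_on r E H U (\<lambda>x. g (f x))"
  using assms(4-6) unfolding Cr_on_iff_Ck_par[OF assms(1,2)] Cr_on_iff_Ck_par[OF assms(2,3)] Cr_on_iff_Ck_par[OF assms(1,3)]
  by (auto intro!: Ck_par_compose[OF assms(1-3), where f = "\<lambda>x p. f x"])

section \<open>Calculus of C^r maps between locally convex spaces\<close>

context
  fixes E :: "'a::real_vector topology"
  assumes E: "lc_space E"
begin

lemma Cr_on_openin: "Cr_on r E F U f \<Longrightarrow> openin E U"
  by (simp add: Cr_on_def)

lemma Cr_on_cong:
  assumes "lc_space F" "\<And>x. x \<in> U \<Longrightarrow> f x = g x" "Cr_on r E F U f"
  shows "Cr_on r E F U g"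
  using assms(2,3) Ck_par_cong[OF E, of U "\<lambda>x p. f x" "\<lambda>x p. g x"]
  unfolding Cr_on_iff_Ck_par[OF E assms(1)] by simp

lemma Cr_on_subset:
  assumes "lc_space F" "Cr_on r E F U f" "openin E N" "N \<subseteq> U"
  shows "Cr_on r E F N f"
  using assms(2-4) Ck_par_subset[OF E] unfolding Cr_on_iff_Ck_par[OF E assms(1)] by blast

lemma Cr_on_local:
  assumes "lc_space F" "openin E U"
    and "\<And>x. x \<in> U \<Longrightarrow> \<exists>N. openin E N \<and> x \<in> N \<and> N \<subseteq> U \<and> Cr_on r E F N f"
  shows "Cr_on r E F U f"
  unfolding Cr_on_iff_Ck_par[OF E assms(1)]
proof (intro conjI allI impI)
  fix k assume k: "enat k \<le> r"
  show "Ck_par E F U k (\<lambda>x p. f x)"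
  proof (rule Ck_par_local[OF E assms(2)])
    fix x assume "x \<in> U"
    from assms(3)[OF this] obtain N where "openin E N \<and> x \<in> N \<and> N \<subseteq> U \<and> Cr_on r E F N f" ..
    then show "\<exists>N. openin E N \<and> x \<in> N \<and> N \<subseteq> U \<and> Ck_par E F N k (\<lambda>x p. f x)"
      using k unfolding Cr_on_iff_Ck_par[OF E assms(1)] by (intro exI[of _ N]) simp
  qed
qed fact

lemma Cr_on_continuous:
  assumes "lc_space F" "Cr_on r E F U f"
  shows "continuous_map (subtopology E U) F f"
proof -
  have "enat 0 \<le> r"
    by (simp flip: zero_enat_def)
  then have "Ck_par E F U 0 (\<lambda>x p. f x)"
    using assms(2) unfolding Cr_on_iff_Ck_par[OF E assms(1)] by blast
  then have f: "cont_on E F U (\<lambda>x p. f x)"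
    by simp
  have "continuous_map (subtopology E U) (prod_topology (subtopology E U) (Par E)) (\<lambda>x. (x, \<lambda>_. 0))"
    using lc_zero[OF E] by (intro continuous_map_pairedI) (simp_all add: Par_iff)
  from continuous_map_compose[OF this f] show ?thesis
    by (simp add: o_def)
qed

lemma Cr_on_const:
  assumes "lc_space F" "openin E U" "c \<in> topspace F"
  shows "Cr_on r E F U (\<lambda>x. c)"
  using assms(2) Ck_par_const[OF E assms(2,1,3)] unfolding Cr_on_iff_Ck_par[OF E assms(1)] by simp

lemma Cr_on_id: "openin E U \<Longrightarrow> Cr_on r E E U (\<lambda>x. x)"
  using Ck_par_id[OF E] unfolding Cr_on_iff_Ck_par[OF E E] by simp

lemma Cr_on_linear:
  assumes "lc_space F" "linear_between E F L" "continuous_map E F L" "openin E U"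
  shows "Cr_on r E F U L"
  using assms(4) Ck_par_linear[OF E assms(4) E assms(1-3) Ck_par_id[OF E assms(4)]]
  unfolding Cr_on_iff_Ck_par[OF E assms(1)] by simp

lemma Cr_on_add:
  assumes "lc_space F" "Cr_on r E F U f" "Cr_on r E F U g"
  shows "Cr_on r E F U (\<lambda>x. f x + g x)"
  using assms(2,3) Ck_par_add[OF E _ assms(1)] unfolding Cr_on_iff_Ck_par[OF E assms(1)] by simp

lemma Cr_on_diff:
  assumes "lc_space F" "Cr_on r E F U f" "Cr_on r E F U g"
  shows "Cr_on r E F U (\<lambda>x. f x - g x)"
  using assms(2,3) Ck_par_diff[OF E _ assms(1)] unfolding Cr_on_iff_Ck_par[OF E assms(1)] by simp

lemma Cr_on_scaleR:
  assumes "lc_space F" "Cr_on r E euclideanreal U s" "Cr_on r E F U f"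
  shows "Cr_on r E F U (\<lambda>x. s x *\<^sub>R f x)"
  using assms(2,3) Ck_par_scaleR[OF E _ assms(1)]
  unfolding Cr_on_iff_Ck_par[OF E assms(1)] Cr_on_iff_Ck_par[OF E lc_space_euclideanreal] by simp

lemma Cr_on_pair:
  assumes "lc_space F" "lc_space H" "Cr_on r E F U f" "Cr_on r E H U g"
  shows "Cr_on r E (prod_topology F H) U (\<lambda>x. (f x, g x))"
  using assms(3,4) Ck_par_pair[OF E _ assms(1,2)]
  unfolding Cr_on_iff_Ck_par[OF E assms(1)] Cr_on_iff_Ck_par[OF E assms(2)]
    Cr_on_iff_Ck_par[OF E lc_space_prod[OF assms(1,2)]] by simp

lemma Cr_on_power:
  assumes F: "lc_space F" and "openin E U" and "\<And>i. i \<in> I \<Longrightarrow> Cr_on r E F U (\<lambda>x. f x i)"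
    and "\<And>x i. i \<notin> I \<Longrightarrow> f x i = 0"
  shows "Cr_on r E (lc_power F I) U f"
  using assms(2-4) Ck_par_power[OF E assms(2) F, of I _ "\<lambda>x p. f x"]
  unfolding Cr_on_iff_Ck_par[OF E F] Cr_on_iff_Ck_par[OF E lc_space_power[OF F]] by simp

lemma Cr_on_real_compose:
  assumes "\<And>g. g \<in> S \<Longrightarrow> \<exists>g'\<in>S. \<forall>x. (g has_real_derivative g' x) (at x)"
    and "g \<in> S" "Cr_on r E euclideanreal U s"
  shows "Cr_on r E euclideanreal U (\<lambda>x. g (s x))"
  using assms(3) Ck_par_real_compose[OF E _ assms(1,2), of U _ "\<lambda>x p. s x"]
  unfolding Cr_on_iff_Ck_par[OF E lc_space_euclideanreal] by simp

end

section \<open>Smooth cutoff functions on the real line\<close>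

text \<open>\<open>flat 1\<close> is the function exp(-1/t) extended by 0. The polynomial in 1/t
  makes the family closed under differentiation.\<close>

definition flat :: "real poly \<Rightarrow> real \<Rightarrow> real" where
  "flat P t = (if t > 0 then poly P (1 / t) * exp (- (1 / t)) else 0)"

lemma poly_times_exp_tendsto_0: "((\<lambda>u. poly P u * exp (- u)) \<longlongrightarrow> 0) at_top" for P :: "real poly"
proof -
  have "((\<lambda>u. \<Sum>i\<le>degree P. coeff P i * (u ^ i / exp u)) \<longlongrightarrow> 0) at_top"
    by (intro tendsto_null_sum tendsto_mult_right_zero tendsto_power_div_exp_0)
  then show ?thesis
    by (simp add: poly_altdef sum_distrib_right exp_minus divide_inverse mult.assoc)
qed

text \<open>With u = 1/t the derivative is u^2 (P(u) - P'(u)) exp(-u), and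
  \<open>[:0, 0, 1:]\<close> is X^2. At 0 the right-hand difference quotient is u P(u) exp(-u),
  which tends to 0 as u grows.\<close>

lemma flat_derivative:
  "(flat P has_real_derivative flat ([:0, 0, 1:] * (P - pderiv P)) x) (at x)"
proof -
  consider "x < 0" | "x = 0" | "x > 0" by linarith
  then show ?thesis
  proof cases
    case 1
    have "((\<lambda>t. 0) has_real_derivative 0) (at x)" by simp
    then have "(flat P has_real_derivative 0) (at x)"
      by (rule DERIV_cong_ev[THEN iffD1, rotated -1, OF _ refl _ refl])
        (use 1 eventually_nhds_in_open[of "{..<0}" x] in \<open>auto simp: flat_def elim!: eventually_mono\<close>)
    then show ?thesis
      using 1 by (simp add: flat_def)
  next
    case 2
    \<comment> \<open>The factor \<open>[:0, 1:]\<close>, that is X, accounts for the division by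
      \<open>h\<close> in the difference quotient.\<close>
    have "((\<lambda>u. poly ([:0, 1:] * P) u * exp (- u)) \<longlongrightarrow> 0) at_top"
      by (rule poly_times_exp_tendsto_0)
    then have "((\<lambda>h. poly ([:0, 1:] * P) (inverse h) * exp (- inverse h)) \<longlongrightarrow> 0) (at_right 0)"
      by (rule filterlim_compose) (rule filterlim_inverse_at_top_right)
    then have r: "((\<lambda>h. (flat P (0 + h) - flat P 0) / h) \<longlongrightarrow> 0) (at_right 0)"
      by (rule Lim_transform_eventually)
        (auto simp: flat_def eventually_at_filter inverse_eq_divide)
    have l: "((\<lambda>h. (flat P (0 + h) - flat P 0) / h) \<longlongrightarrow> 0) (at_left 0)"
      by (rule tendsto_eventually) (auto simp: flat_def eventually_at_filter)
    have "((\<lambda>h. (flat P (0 + h) - flat P 0) / h) \<longlongrightarrow> 0) (at 0)"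
      using l r by (simp add: filterlim_at_split)
    then show ?thesis
      using 2 by (simp add: DERIV_def flat_def)
  next
    case 3
    have "((\<lambda>t. poly P (1 / t) * exp (- (1 / t))) has_real_derivative
        flat ([:0, 0, 1:] * (P - pderiv P)) x) (at x)"
      using 3 by (auto intro!: derivative_eq_intros DERIV_chain2[OF poly_DERIV]
          simp: flat_def field_simps power2_eq_square)
    then show ?thesis
      by (rule DERIV_cong_ev[THEN iffD1, rotated -1, OF _ refl _ refl])
        (use 3 eventually_nhds_in_open[of "{0<..}" x] in \<open>auto simp: flat_def elim!: eventually_mono\<close>)
  qed
qed

text \<open>Generated by the operations that build cutoffs, so that closure under differentiation is
  an induction on the formation. The affine argument provides translates, dilations and
  reflections.\<close>

inductive_set smooth_funs :: "(real \<Rightarrow> real) set" where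
  flat: "(\<lambda>t. flat P (a * t + b)) \<in> smooth_funs"
| const: "(\<lambda>t. c) \<in> smooth_funs"
| add: "f \<in> smooth_funs \<Longrightarrow> g \<in> smooth_funs \<Longrightarrow> (\<lambda>t. f t + g t) \<in> smooth_funs"
| mult: "f \<in> smooth_funs \<Longrightarrow> g \<in> smooth_funs \<Longrightarrow> (\<lambda>t. f t * g t) \<in> smooth_funs"
| inverse: "f \<in> smooth_funs \<Longrightarrow> (\<And>t. f t \<noteq> 0) \<Longrightarrow> (\<lambda>t. inverse (f t)) \<in> smooth_funs"

lemma smooth_funs_derivative:
  "f \<in> smooth_funs \<Longrightarrow> \<exists>f'\<in>smooth_funs. \<forall>x. (f has_real_derivative f' x) (at x)"
proof (induction rule: smooth_funs.induct)
  case (flat P a b)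
  show ?case
  proof (intro bexI allI)
    show "((\<lambda>t. flat P (a * t + b)) has_real_derivative
        flat ([:0, 0, 1:] * (P - pderiv P)) (a * x + b) * a) (at x)" for x
      by (rule DERIV_chain2[OF flat_derivative]) (auto intro!: derivative_eq_intros)
    show "(\<lambda>x. flat ([:0, 0, 1:] * (P - pderiv P)) (a * x + b) * a) \<in> smooth_funs"
      by (intro smooth_funs.intros)
  qed
next
  case (const c)
  show ?case
    by (rule bexI[of _ "\<lambda>t. 0"]) (auto intro: smooth_funs.intros)
next
  case (add f g)
  then obtain f' g' where "f' \<in> smooth_funs" "g' \<in> smooth_funs"
    "\<And>x. (f has_real_derivative f' x) (at x)" "\<And>x. (g has_real_derivative g' x) (at x)"
    by blast
  then show ?case
    by (intro bexI[of _ "\<lambda>t. f' t + g' t"] smooth_funs.add allI DERIV_add)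
next
  case (mult f g)
  then obtain f' g' where "f' \<in> smooth_funs" "g' \<in> smooth_funs"
    "\<And>x. (f has_real_derivative f' x) (at x)" "\<And>x. (g has_real_derivative g' x) (at x)"
    by blast
  with mult.hyps show ?case
    by (intro bexI[of _ "\<lambda>t. f' t * g t + g' t * f t"] smooth_funs.add smooth_funs.mult allI DERIV_mult)
next
  case (inverse f)
  then obtain f' where "f' \<in> smooth_funs" "\<And>x. (f has_real_derivative f' x) (at x)"
    by blast
  with inverse.hyps show ?case
    by (intro bexI[of _ "\<lambda>t. (- 1) * (inverse (f t) * f' t * inverse (f t))"]
        smooth_funs.mult smooth_funs.const smooth_funs.inverse allI)
      (auto intro!: derivative_eq_intros)
qed

text \<open>With s = a t + b and e = \<open>flat 1\<close>, the function is e(s) / (e(s) + e(1 -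
  s)). The denominator is positive because s and 1 - s are not both nonpositive; e(s) vanishes for s
  \<le> 0, and e(1 - s) for s \<ge> 1.\<close>

lemma smooth_step:
  fixes a b :: real
  shows "\<exists>f\<in>smooth_funs. \<forall>t. (a * t + b \<le> 0 \<longrightarrow> f t = 0) \<and> (1 \<le> a * t + b \<longrightarrow> f t = 1)"
proof -
  define f where "f t = flat 1 (a * t + b) * inverse (flat 1 (a * t + b) + flat 1 (- a * t + (1 - b)))" for t
  have pos: "flat 1 (a * t + b) + flat 1 (- a * t + (1 - b)) \<noteq> 0" for t
  proof -
    have "flat 1 s \<ge> 0" "s > 0 \<Longrightarrow> flat 1 s > 0" for s
      by (auto simp: flat_def)
    moreover have "a * t + b > 0 \<or> - a * t + (1 - b) > 0"
      by linarith
    ultimately show ?thesis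
      by (metis add_pos_nonneg add_nonneg_pos less_numeral_extra(3))
  qed
  have "f \<in> smooth_funs"
    unfolding f_def by (intro smooth_funs.intros pos)
  moreover have "f t = 0" if "a * t + b \<le> 0" for t
    using that by (simp add: f_def flat_def)
  moreover have "f t = 1" if "1 \<le> a * t + b" for t
  proof -
    have "flat 1 (- a * t + (1 - b)) = 0"
      using that by (simp add: flat_def)
    then show ?thesis
      using pos[of t] by (simp add: f_def)
  qed
  ultimately show ?thesis by blast
qed

text \<open>The product of a step rising between s - 2\<delta> and s - \<delta> and one falling
  between s + \<delta> and s + 2\<delta>. The constant 2 in the affine arguments places the
  transitions there.\<close>

lemma smooth_bump:
  fixes s :: real
  assumes "\<delta> > 0"
  obtains f where "f \<in> smooth_funs" "\<And>t. \<bar>t - s\<bar> \<le> \<delta> \<Longrightarrow> f t = 1" "\<And>t. 2 * \<delta> \<le> \<bar>t - s\<bar> \<Longrightarrow> f t = 0"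
proof -
  have arg: "(1 / \<delta>) * t + (2 - s / \<delta>) = 2 + (t - s) / \<delta>"
      "(- 1 / \<delta>) * t + (2 + s / \<delta>) = 2 - (t - s) / \<delta>" for t
    by (simp_all add: diff_divide_distrib)
  obtain f where f: "f \<in> smooth_funs" "\<And>t. 2 + (t - s) / \<delta> \<le> 0 \<Longrightarrow> f t = 0"
      "\<And>t. 1 \<le> 2 + (t - s) / \<delta> \<Longrightarrow> f t = 1"
    using smooth_step[of "1 / \<delta>" "2 - s / \<delta>"] unfolding arg by blast
  obtain g where g: "g \<in> smooth_funs" "\<And>t. 2 - (t - s) / \<delta> \<le> 0 \<Longrightarrow> g t = 0"
      "\<And>t. 1 \<le> 2 - (t - s) / \<delta> \<Longrightarrow> g t = 1"
    using smooth_step[of "- 1 / \<delta>" "2 + s / \<delta>"] unfolding arg by blast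
  have abs: "\<bar>(t - s) / \<delta>\<bar> = \<bar>t - s\<bar> / \<delta>" for t
    using assms by simp
  show thesis
  proof
    show "(\<lambda>t. f t * g t) \<in> smooth_funs"
      using f g by (intro smooth_funs.mult)
    show "f t * g t = 1" if "\<bar>t - s\<bar> \<le> \<delta>" for t
    proof -
      have "\<bar>(t - s) / \<delta>\<bar> \<le> 1"
        unfolding abs using that assms by simp
      then have "f t = 1" "g t = 1"
        using f(3)[of t] g(3)[of t] by linarith+
      then show ?thesis by simp
    qed
    show "f t * g t = 0" if "2 * \<delta> \<le> \<bar>t - s\<bar>" for t
    proof -
      have "2 \<le> \<bar>(t - s) / \<delta>\<bar>"
        unfolding abs using that assms by (simp add: le_divide_eq)
      then have "2 + (t - s) / \<delta> \<le> 0 \<or> 2 - (t - s) / \<delta> \<le> 0"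
        by linarith
      then show ?thesis
        using f(2) g(2) by auto
    qed
  qed
qed

section \<open>Charts of locally convex spaces and of manifolds\<close>

lemma inv_into_topspace_id: "x \<in> topspace E \<Longrightarrow> inv_into (topspace E) (\<lambda>x. x) x = x"
  by (simp add: inv_into_f_f[of "\<lambda>x. x" "topspace E" x, simplified])

text \<open>For a self-bijection of an open set \<open>V\<close> the chart image is \<open>V\<close>
  again, and the two transitions with the identity chart are \<psi> and its inverse \<psi>'.\<close>

lemma lc_atlasI:
  assumes P: "lc_space P" and V: "openin P V" and img: "\<psi> ` V \<subseteq> V" "\<psi>' ` V \<subseteq> V"
    and \<psi>: "Cr_on r P P V \<psi>" and \<psi>': "Cr_on r P P V \<psi>'"
    and inv: "\<And>p. p \<in> V \<Longrightarrow> \<psi>' (\<psi> p) = p" "\<And>p. p \<in> V \<Longrightarrow> \<psi> (\<psi>' p) = p"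
  shows "(V, \<psi>) \<in> lc_atlas r P"
proof -
  have sub: "V \<subseteq> topspace P"
    using V by (rule openin_subset)
  have image: "\<psi> ` V = V"
    using img inv by (metis antisym image_eqI image_subset_iff subsetI)
  have "homeomorphic_maps (subtopology P V) (subtopology P V) \<psi> \<psi>'"
    using Cr_on_continuous[OF P P \<psi>] Cr_on_continuous[OF P P \<psi>'] img inv
    by (auto simp: homeomorphic_maps_def continuous_map_in_subtopology)
  then have "is_chart P P (V, \<psi>)"
    using V by (auto simp: is_chart_def image intro: homeomorphic_maps_imp_map)
  moreover have "Cr_transition r P (topspace P, \<lambda>x. x) (V, \<psi>)"
  proof -
    have "Cr_on r P P V (\<psi> \<circ> inv_into (topspace P) (\<lambda>x. x))"
      by (rule Cr_on_cong[OF P P _ \<psi>]) (use sub inv_into_topspace_id in \<open>auto simp: o_def\<close>)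
    then show ?thesis
      using sub by (simp add: Cr_transition_def Int_absorb1)
  qed
  moreover have "Cr_transition r P (V, \<psi>) (topspace P, \<lambda>x. x)"
  proof -
    have "inj_on \<psi> V"
      using inv(1) by (rule inj_on_inverseI)
    then have "inv_into V \<psi> p = \<psi>' p" if "p \<in> V" for p
      using inv_into_f_f[of \<psi> V "\<psi>' p"] inv(2)[OF that] that img(2) by (metis image_subset_iff)
    then have "Cr_on r P P V ((\<lambda>x. x) \<circ> inv_into V \<psi>)"
      by (intro Cr_on_cong[OF P P _ \<psi>']) simp
    then show ?thesis
      using sub image by (simp add: Cr_transition_def Int_absorb2)
  qed
  ultimately show ?thesis
    by (simp add: lc_atlas_def)
qed

lemma lc_atlas_id:
  assumes "lc_space P"
  shows "(topspace P, \<lambda>x. x) \<in> lc_atlas r P"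
  using Cr_on_id[OF assms openin_topspace]
  by (intro lc_atlasI[OF assms openin_topspace, where \<psi>' = "\<lambda>x. x"]) auto

lemma lc_atlas_Cr_on:
  assumes P: "lc_space P" and "(V, \<psi>) \<in> lc_atlas r P"
  shows "openin P V" "Cr_on r P P V \<psi>"
proof -
  show V: "openin P V"
    using assms(2) by (simp add: lc_atlas_def is_chart_def)
  have "Cr_on r P P V (\<psi> \<circ> inv_into (topspace P) (\<lambda>x. x))"
    using assms(2) openin_subset[OF V] by (simp add: lc_atlas_def Cr_transition_def Int_absorb1)
  then show "Cr_on r P P V \<psi>"
    by (rule Cr_on_cong[OF P P, rotated]) (use openin_subset[OF V] inv_into_topspace_id in \<open>auto simp: o_def\<close>)
qed

text \<open>If \<open>\<tau>\<close> has values in the kernel of \<open>\<pi>\<close>, the shear \<open>p \<mapsto> p - \<tau> (\<pi> p)\<close> has the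
  inverse \<open>q \<mapsto> q + \<tau> (\<pi> q)\<close>.\<close>

lemma shear_chart:
  assumes P: "lc_space P" and E: "lc_space E"
    and \<pi>: "linear_between P E \<pi>" "continuous_map P E \<pi>"
    and \<tau>: "Cr_on r E P O' \<tau>" "\<And>v. v \<in> O' \<Longrightarrow> \<pi> (\<tau> v) = 0"
  shows "({p \<in> topspace P. \<pi> p \<in> O'}, \<lambda>p. p - \<tau> (\<pi> p)) \<in> lc_atlas r P"
proof (rule lc_atlasI[OF P, where \<psi>' = "\<lambda>q. q + \<tau> (\<pi> q)"])
  let ?V = "{p \<in> topspace P. \<pi> p \<in> O'}"
  have O': "openin E O'"
    using \<tau>(1) by (rule Cr_on_openin[OF E])
  show V: "openin P ?V"
    by (rule openin_continuous_map_preimage[OF \<pi>(2) O'])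
  have \<tau>_in: "\<tau> v \<in> topspace P" if "v \<in> O'" for v
    using continuous_map_image_subset_topspace[OF Cr_on_continuous[OF E P \<tau>(1)]] that openin_subset[OF O']
    by auto
  have \<tau>\<pi>: "Cr_on r P P ?V (\<lambda>p. \<tau> (\<pi> p))"
    by (rule Cr_on_compose[OF P E P \<tau>(1) Cr_on_linear[OF P E \<pi> V]]) auto
  show "Cr_on r P P ?V (\<lambda>p. p - \<tau> (\<pi> p))" "Cr_on r P P ?V (\<lambda>p. p + \<tau> (\<pi> p))"
    by (intro Cr_on_diff[OF P P] Cr_on_add[OF P P] Cr_on_id[OF P V] \<tau>\<pi>)+
  \<comment> \<open>Neither shear changes \<pi>, so both preserve \<open>V\<close> and both use the
    same correction \<open>\<tau> (\<pi> p)\<close>, which therefore cancels.\<close>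
  have add: "\<pi> (p + \<tau> (\<pi> p)) = \<pi> p" if "p \<in> ?V" for p
    using that \<pi>(1) \<tau>(2) \<tau>_in by (simp add: linear_between_def)
  have diff: "\<pi> (p - \<tau> (\<pi> p)) = \<pi> p" if "p \<in> ?V" for p
  proof -
    have "\<pi> (p - \<tau> (\<pi> p)) = \<pi> (p - \<tau> (\<pi> p)) + \<pi> (\<tau> (\<pi> p))"
      using that \<tau>(2) by simp
    also have "\<dots> = \<pi> (p - \<tau> (\<pi> p) + \<tau> (\<pi> p))"
      using that \<pi>(1) \<tau>_in[of "\<pi> p"] lc_diff[OF P, of p "\<tau> (\<pi> p)"] unfolding linear_between_def
      by (metis (mono_tags, lifting) mem_Collect_eq)
    finally show ?thesis by simp
  qed
  show "(\<lambda>p. p - \<tau> (\<pi> p)) ` ?V \<subseteq> ?V" "(\<lambda>p. p + \<tau> (\<pi> p)) ` ?V \<subseteq> ?V"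
    using add diff \<tau>_in lc_diff[OF P] lc_add[OF P] by auto
  show "p - \<tau> (\<pi> p) + \<tau> (\<pi> (p - \<tau> (\<pi> p))) = p" "p + \<tau> (\<pi> p) - \<tau> (\<pi> (p + \<tau> (\<pi> p))) = p"
    if "p \<in> ?V" for p
    by (simp_all only: add[OF that] diff[OF that]) simp_all
qed

text \<open>j \<circ> \<pi> is a continuous linear projection of \<open>P\<close> onto the image of
  \<open>j\<close>, and the kernel \<open>C\<close> of \<pi> is the complement. The inverse of
  addition sends p to (j(\<pi> p), p - j(\<pi> p)).\<close>

lemma retract_complemented:
  assumes P: "lc_space P" and E: "lc_space E"
    and \<pi>: "linear_between P E \<pi>" "continuous_map P E \<pi>"
    and j: "linear_between E P j" "continuous_map E P j"
    and inv: "\<And>v. v \<in> topspace E \<Longrightarrow> \<pi> (j v) = v"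
  shows "embedding_map E P j" "complemented_subspace P (j ` topspace E)"
proof -
  show "embedding_map E P j"
    using \<pi>(2) j(2) inv
    by (intro section_imp_embedding_map) (auto simp: section_map_def retraction_maps_def)
  note memE = lc_space_mem[OF E] and memP = lc_space_mem[OF P]
  have j_in: "j v \<in> topspace P" if "v \<in> topspace E" for v
    using j(1) that by (auto simp: linear_between_def)
  have \<pi>_in: "\<pi> p \<in> topspace E" if "p \<in> topspace P" for p
    using \<pi>(1) that by (auto simp: linear_between_def)
  have \<pi>_0: "\<pi> 0 = 0"
    using \<pi>(1) memP(1) unfolding linear_between_def by (metis scale_zero_left)
  have j_0: "j 0 = 0"
    using j(1) memE(1) unfolding linear_between_def by (metis scale_zero_left)
  have \<pi>_add: "\<pi> (p + q) = \<pi> p + \<pi> q" if "p \<in> topspace P" "q \<in> topspace P" for p q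
    using \<pi>(1) that by (simp add: linear_between_def)
  have \<pi>_diff: "\<pi> (p - q) = \<pi> p - \<pi> q" if "p \<in> topspace P" "q \<in> topspace P" for p q
    using \<pi>_add[of "p - q" q] memP that by simp
  define C where "C = {p \<in> topspace P. \<pi> p = 0}"
  let ?F = "j ` topspace E"
  have C: "subspace C" "C \<subseteq> topspace P"
    using \<pi>(1) memP \<pi>_0 by (auto simp: C_def subspace_def linear_between_def)
  have F: "subspace ?F" "?F \<subseteq> topspace P"
  proof -
    have "j v + j w \<in> ?F" "c *\<^sub>R j v \<in> ?F" if "v \<in> topspace E" "w \<in> topspace E" for v w c
      using that j(1) memE unfolding linear_between_def by (metis image_eqI)+
    then show "subspace ?F"
      using j_0 memE(1) by (auto simp: subspace_def intro: image_eqI[of _ _ 0])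
    show "?F \<subseteq> topspace P"
      using j_in by auto
  qed
  have "homeomorphic_maps (prod_topology (subtopology P ?F) (subtopology P C)) P
      (\<lambda>(x, y). x + y) (\<lambda>p. (j (\<pi> p), p - j (\<pi> p)))"
    unfolding homeomorphic_maps_def
  proof (intro conjI ballI)
    have "continuous_map (prod_topology (subtopology P ?F) (subtopology P C)) P fst"
      "continuous_map (prod_topology (subtopology P ?F) (subtopology P C)) P snd"
      by (auto intro: continuous_map_into_fulltopology continuous_map_fst continuous_map_snd)
    then show "continuous_map (prod_topology (subtopology P ?F) (subtopology P C)) P (\<lambda>(x, y). x + y)"
      unfolding case_prod_unfold by (intro lc_continuous_add[OF P])
    have j\<pi>: "continuous_map P P (\<lambda>p. j (\<pi> p))"
      using continuous_map_compose[OF \<pi>(2) j(2)] by (simp add: o_def)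
    show "continuous_map P (prod_topology (subtopology P ?F) (subtopology P C)) (\<lambda>p. (j (\<pi> p), p - j (\<pi> p)))"
    proof (intro continuous_map_pairedI)
      show "continuous_map P (subtopology P ?F) (\<lambda>p. j (\<pi> p))"
        using j\<pi> \<pi>_in by (auto simp: continuous_map_in_subtopology)
      have "continuous_map P P (\<lambda>p. p - j (\<pi> p))"
        using j\<pi> by (intro lc_continuous_diff[OF P]) auto
      moreover have "p - j (\<pi> p) \<in> C" if "p \<in> topspace P" for p
        using that by (simp add: C_def memP j_in \<pi>_in \<pi>_diff inv)
      ultimately show "continuous_map P (subtopology P C) (\<lambda>p. p - j (\<pi> p))"
        by (auto simp: continuous_map_in_subtopology)
    qed
    fix p assume "p \<in> topspace P"
    then show "(case (j (\<pi> p), p - j (\<pi> p)) of (x, y) \<Rightarrow> x + y) = p"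
      by simp
  next
    fix z assume "z \<in> topspace (prod_topology (subtopology P ?F) (subtopology P C))"
    then obtain v c where z: "z = (j v, c)" "v \<in> topspace E" "c \<in> C"
      by auto
    then have "\<pi> (j v + c) = v"
      using j_in inv by (simp add: C_def \<pi>_add)
    then show "(j (\<pi> (case z of (x, y) \<Rightarrow> x + y)), (case z of (x, y) \<Rightarrow> x + y) - j (\<pi> (case z of (x, y) \<Rightarrow> x + y))) = z"
      by (simp add: z(1))
  qed
  then show "complemented_subspace P ?F"
    unfolding complemented_subspace_def using C F homeomorphic_maps_imp_map by blast
qed

section \<open>Charts of a manifold and maps into locally convex spaces\<close>

locale Cr_mfd =
  fixes r :: enat and M :: "'m topology" and E :: "'e::real_vector topology" and A :: "('m, 'e) chart set"
  assumes Cr_manifold: "Cr_manifold r M E A"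
begin

lemma E: "lc_space E"
  and M: "Hausdorff_space M"
  and atlas: "Cr_atlas r M E A"
  and maximal: "\<And>B. Cr_atlas r M E B \<Longrightarrow> A \<subseteq> B \<Longrightarrow> B = A"
  using Cr_manifold by (auto simp: Cr_manifold_def maximal_Cr_atlas_def)

lemma chart:
  assumes "(U, \<phi>) \<in> A"
  shows chart_openin: "openin M U"
    and chart_inj: "inj_on \<phi> U"
    and chart_homeo: "homeomorphic_map (subtopology M U) (subtopology E (\<phi> ` U)) \<phi>"
    and chart_image_openin: "\<And>W. openin M W \<Longrightarrow> W \<subseteq> U \<Longrightarrow> openin E (\<phi> ` W)"
proof -
  have U: "is_chart M E (U, \<phi>)"
    using atlas assms by (simp add: Cr_atlas_def)
  then show o: "openin M U" and h: "homeomorphic_map (subtopology M U) (subtopology E (\<phi> ` U)) \<phi>"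
    by (auto simp: is_chart_def)
  have oi: "openin E (\<phi> ` U)"
    using U by (simp add: is_chart_def)
  show "inj_on \<phi> U"
    using h openin_subset[OF o] by (simp add: homeomorphic_map_def Int_absorb1)
  show "openin E (\<phi> ` W)" if W: "openin M W" "W \<subseteq> U" for W
  proof -
    have "openin (subtopology M U) W"
      using W o by (simp add: openin_open_subtopology)
    then have "openin (subtopology E (\<phi> ` U)) (\<phi> ` W)"
      using homeomorphic_imp_open_map[OF h] by (simp add: open_map_def)
    then show ?thesis
      using oi by (simp add: openin_open_subtopology)
  qed
qed

lemma chart_inv: "(U, \<phi>) \<in> A \<Longrightarrow> y \<in> U \<Longrightarrow> inv_into U \<phi> (\<phi> y) = y"
  by (simp add: chart_inj)

lemma chart_at:
  assumes "x \<in> topspace M"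
  obtains U \<phi> where "(U, \<phi>) \<in> A" "x \<in> U"
  using atlas assms by (fastforce simp: Cr_atlas_def)

lemma chart_transition:
  assumes "(U, \<phi>) \<in> A" "(V, \<psi>) \<in> A"
  shows "Cr_on r E E (\<phi> ` (U \<inter> V)) (\<psi> \<circ> inv_into U \<phi>)"
  using atlas assms by (fastforce simp: Cr_atlas_def Cr_transition_def)

text \<open>Adding the restricted chart leaves an atlas, so maximality puts it into
  \<open>A\<close>. It is used to pass from the domain of a chart to the smaller set on which a
  cutoff equals 1.\<close>

lemma chart_restrict:
  assumes A: "(U, \<phi>) \<in> A" and N: "openin M N" "N \<subseteq> U"
  shows "(N, \<phi>) \<in> A"
proof -
  have sub: "Cr_transition r E (U', \<phi>') (V', \<psi>')"
    if "(U1, \<phi>') \<in> A" "(V1, \<psi>') \<in> A" "openin M U'" "openin M V'" "U' \<subseteq> U1" "V' \<subseteq> V1" for U' V' U1 V1 \<phi>' \<psi>'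
  proof -
    have "openin E (\<phi>' ` (U' \<inter> V'))"
      using that by (intro chart_image_openin[OF that(1)]) auto
    then have 1: "Cr_on r E E (\<phi>' ` (U' \<inter> V')) (\<psi>' \<circ> inv_into U1 \<phi>')"
      using that by (intro Cr_on_subset[OF E E chart_transition[OF that(1,2)]]) auto
    \<comment> \<open>The value of \<open>inv_into\<close> depends on the stated domain; injectivity
      on the larger one makes both choices agree on the smaller image.\<close>
    have 2: "inv_into U1 \<phi>' v = inv_into U' \<phi>' v" if "v \<in> \<phi>' ` (U' \<inter> V')" for v
    proof -
      obtain y where y: "v = \<phi>' y" "y \<in> U'"
        using \<open>v \<in> \<phi>' ` (U' \<inter> V')\<close> by auto
      have "inj_on \<phi>' U'"
        using chart_inj[OF \<open>(U1, \<phi>') \<in> A\<close>] \<open>U' \<subseteq> U1\<close> inj_on_subset by blast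
      then show ?thesis
        using y chart_inv[OF \<open>(U1, \<phi>') \<in> A\<close>] \<open>U' \<subseteq> U1\<close> by (auto simp: inv_into_f_f)
    qed
    have "Cr_on r E E (\<phi>' ` (U' \<inter> V')) (\<psi>' \<circ> inv_into U' \<phi>')"
      by (rule Cr_on_cong[OF E E _ 1]) (simp add: 2)
    then show ?thesis
      by (simp add: Cr_transition_def)
  qed
  have "is_chart M E (N, \<phi>)"
  proof -
    have "homeomorphic_map (subtopology (subtopology M U) N) (subtopology (subtopology E (\<phi> ` U)) (\<phi> ` N)) \<phi>"
      using N openin_subset[OF N(1)]
      by (intro homeomorphic_map_subtopologies_alt[OF chart_homeo[OF A]]) (auto simp: inj_on_image_mem_iff[OF chart_inj[OF A]])
    then have "homeomorphic_map (subtopology M N) (subtopology E (\<phi> ` N)) \<phi>"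
      using N(2) by (simp add: subtopology_subtopology Int_absorb1 image_mono)
    then show ?thesis
      using N chart_image_openin[OF A N] by (simp add: is_chart_def)
  qed
  have "Cr_atlas r M E (insert (N, \<phi>) A)"
    unfolding Cr_atlas_def
  proof (intro conjI ballI)
    show "is_chart M E c" if "c \<in> insert (N, \<phi>) A" for c
      using that \<open>is_chart M E (N, \<phi>)\<close> atlas by (auto simp: Cr_atlas_def)
    show "\<Union> (fst ` insert (N, \<phi>) A) = topspace M"
      using atlas openin_subset[OF N(1)] by (auto simp: Cr_atlas_def)
    \<comment> \<open>Every member of the enlarged family restricts a chart of \<open>A\<close>, the
      old ones trivially, so \<open>sub\<close> settles all pairs at once.\<close>
    have big: "\<exists>V1. (V1, snd c) \<in> A \<and> openin M (fst c) \<and> fst c \<subseteq> V1" if "c \<in> insert (N, \<phi>) A" for c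
      using that A N chart_openin by (cases c) auto
    fix c d assume cd: "c \<in> insert (N, \<phi>) A" "d \<in> insert (N, \<phi>) A"
    obtain U1 V1 where "(U1, snd c) \<in> A \<and> openin M (fst c) \<and> fst c \<subseteq> U1"
        "(V1, snd d) \<in> A \<and> openin M (fst d) \<and> fst d \<subseteq> V1"
      using big[OF cd(1)] big[OF cd(2)] by blast
    then have "Cr_transition r E (fst c, snd c) (fst d, snd d)"
      by (intro sub) auto
    then show "Cr_transition r E c d"
      by simp
  qed
  from maximal[OF this] show ?thesis
    by blast
qed

text \<open>The C^r condition tested in the identity chart of the target alone. Continuity follows
  from it, and for locally convex targets the condition is equivalent to \<open>Cr_map\<close> with
  the full standard atlas.\<close>

definition Cr_into :: "'f::real_vector topology \<Rightarrow> ('m \<Rightarrow> 'f) \<Rightarrow> bool" where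
  "Cr_into F f \<longleftrightarrow> (\<forall>(U, \<phi>)\<in>A. Cr_on r E F (\<phi> ` U) (\<lambda>v. f (inv_into U \<phi> v)))"

lemma Cr_intoD: "Cr_into F f \<Longrightarrow> (U, \<phi>) \<in> A \<Longrightarrow> Cr_on r E F (\<phi> ` U) (\<lambda>v. f (inv_into U \<phi> v))"
  by (auto simp: Cr_into_def)

lemma Cr_into_continuous:
  assumes F: "lc_space F" and f: "Cr_into F f"
  shows "continuous_map M F f"
proof (rule pasting_lemma[where I = A and T = fst and f = "\<lambda>_. f"])
  fix c assume "c \<in> A"
  then obtain U \<phi> where c: "c = (U, \<phi>)" "(U, \<phi>) \<in> A"
    by (cases c) auto
  show "openin M (fst c)"
    using chart_openin[OF c(2)] by (simp add: c(1))
  have "continuous_map (subtopology M U) F ((\<lambda>v. f (inv_into U \<phi> v)) \<circ> \<phi>)"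
    by (rule continuous_map_compose[OF homeomorphic_imp_continuous_map[OF chart_homeo[OF c(2)]]
          Cr_on_continuous[OF E F Cr_intoD[OF f c(2)]]])
  then have "continuous_map (subtopology M U) F f"
    by (rule continuous_map_eq) (use chart_inv[OF c(2)] in auto)
  then show "continuous_map (subtopology M (fst c)) F f"
    by (simp add: c(1))
next
  show "\<exists>c. c \<in> A \<and> x \<in> fst c \<and> f x = f x" if "x \<in> topspace M" for x
    using chart_at[OF that] by (metis fst_conv)
qed simp

text \<open>Target charts are themselves C^r maps on open subsets of \<open>P\<close>, so the chain
  rule passes from the identity chart to all of them.\<close>

lemma Cr_into_Cr_map:
  assumes P: "lc_space P" and f: "Cr_into P f"
  shows "Cr_map r M E A P P (lc_atlas r P) f"
  unfolding Cr_map_def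
proof (intro conjI ballI, goal_cases)
  case 1
  show ?case
    by (rule Cr_into_continuous[OF P f])
next
  case (2 c)
  obtain U \<phi> where c: "c = (U, \<phi>)" "(U, \<phi>) \<in> A"
    using 2 by (cases c) auto
  have "Cr_on r E P (\<phi> ` (U \<inter> f -` V)) (\<psi> \<circ> f \<circ> inv_into U \<phi>)" if d: "(V, \<psi>) \<in> lc_atlas r P" for V \<psi>
  proof -
    note V = lc_atlas_Cr_on[OF P d]
    have "U \<inter> f -` V = U \<inter> {x \<in> topspace M. f x \<in> V}"
      using openin_subset[OF chart_openin[OF c(2)]] by auto
    then have "openin M (U \<inter> f -` V)"
      using chart_openin[OF c(2)] openin_continuous_map_preimage[OF Cr_into_continuous[OF P f] V(1)]
      by (simp add: openin_Int)
    then have "openin E (\<phi> ` (U \<inter> f -` V))"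
      by (intro chart_image_openin[OF c(2)]) auto
    then have "Cr_on r E P (\<phi> ` (U \<inter> f -` V)) (\<lambda>v. f (inv_into U \<phi> v))"
      by (rule Cr_on_subset[OF E P Cr_intoD[OF f c(2)]]) auto
    moreover have "(\<lambda>v. f (inv_into U \<phi> v)) ` \<phi> ` (U \<inter> f -` V) \<subseteq> V"
      using chart_inv[OF c(2)] by auto
    ultimately show ?thesis
      unfolding o_def by (rule Cr_on_compose[OF E P P V(2)])
  qed
  then show ?case
    by (auto simp: c(1))
qed

lemma Cr_map_Cr_into:
  assumes F: "lc_space F" and f: "Cr_map r M E A F F (lc_atlas r F) f"
  shows "Cr_into F f"
  unfolding Cr_into_def
proof clarify
  fix U \<phi> assume U: "(U, \<phi>) \<in> A"
  have "Cr_on r E F (\<phi> ` (U \<inter> f -` topspace F)) ((\<lambda>x. x) \<circ> f \<circ> inv_into U \<phi>)"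
    using f U lc_atlas_id[OF F, of r] by (fastforce simp: Cr_map_def)
  moreover have "U \<inter> f -` topspace F = U"
  proof -
    have "continuous_map M F f"
      using f by (simp add: Cr_map_def)
    from continuous_map_image_subset_topspace[OF this] show ?thesis
      using openin_subset[OF chart_openin[OF U]] by auto
  qed
  ultimately show "Cr_on r E F (\<phi> ` U) (\<lambda>v. f (inv_into U \<phi> v))"
    by (simp add: o_def)
qed

end

section \<open>Cutoff functions on a regular manifold\<close>

context Cr_mfd
begin

lemma Cr_into_mult:
  assumes "Cr_into euclideanreal f" "Cr_into euclideanreal g"
  shows "Cr_into euclideanreal (\<lambda>y. f y * g y)"
  unfolding Cr_into_def
proof clarify
  fix U \<phi> assume U: "(U, \<phi>) \<in> A"
  show "Cr_on r E euclideanreal (\<phi> ` U) (\<lambda>v. f (inv_into U \<phi> v) * g (inv_into U \<phi> v))"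
    using Cr_on_scaleR[OF E lc_space_euclideanreal Cr_intoD[OF assms(1) U] Cr_intoD[OF assms(2) U]] by simp
qed

text \<open>Induction on the generation of the topology by its subbasis: for a finite intersection
  multiply the cutoffs, for a union take that of one member, and for a subbasic set compose a bump
  with the defining function. The closed set \<open>C\<close> is recorded because its complement is
  open, which makes an extension by 0 across the boundary of \<open>W\<close> a C^r map.\<close>

lemma cutoff_exists:
  assumes reg: "Cr_regular r M E A" and W: "openin M W" "x \<in> W"
  shows "\<exists>h N C. Cr_into euclideanreal h \<and> openin M N \<and> x \<in> N \<and> (\<forall>y\<in>N. h y = 1) \<and>
    closedin M C \<and> C \<subseteq> W \<and> (\<forall>y\<in>topspace M - C. h y = 0)"
proof -
  let ?S = "{f -` W \<inter> topspace M |f W.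
      Cr_map r M E A euclideanreal euclideanreal (lc_atlas r euclideanreal) f \<and> open W}"
  let ?P = "\<lambda>W x h N C. Cr_into euclideanreal h \<and> openin M N \<and> x \<in> N \<and> (\<forall>y\<in>N. h y = 1) \<and>
    closedin M C \<and> C \<subseteq> W \<and> (\<forall>y\<in>topspace M - C. h y = 0)"
  have "openin (topology_generated_by ?S) W"
    using reg W(1) unfolding Cr_regular_def by simp
  then have "generate_topology_on ?S W"
    by (rule openin_topology_generated_by)
  from this W(2) show ?thesis
  proof (induction arbitrary: x)
    case (Int a b)
    from Int.prems obtain h N C h' N' C' where "?P a x h N C" "?P b x h' N' C'"
      using Int.IH[of x] by auto
    then have "?P (a \<inter> b) x (\<lambda>y. h y * h' y) (N \<inter> N') (C \<inter> C')"
      using Cr_into_mult[of h h'] by auto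
    then show ?case by blast
  next
    case (UN K)
    then obtain k where k: "k \<in> K" "x \<in> k" by blast
    from UN.IH[OF this] obtain h N C where "?P k x h N C" by blast
    then have "?P (\<Union>K) x h N C"
      using k(1) by auto
    then show ?case by blast
  next
    case (Basis s)
    then obtain f O' where f: "Cr_map r M E A euclideanreal euclideanreal (lc_atlas r euclideanreal) f"
        "open O'" "s = f -` O' \<inter> topspace M"
      by blast
    have fc: "continuous_map M euclideanreal f"
      using f(1) by (simp add: Cr_map_def)
    have x: "x \<in> topspace M" "f x \<in> O'"
      using Basis.prems f(3) by auto
    \<comment> \<open>The closed ball of radius \<open>e\<close> fits into \<open>O'\<close>. The
      bump is 1 up to distance \<open>e / 2\<close> and 0 from distance \<open>e\<close> on, so the
      open half ball yields \<open>N\<close> and the closed ball yields \<open>C\<close>.\<close>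
    obtain e where e: "e > 0" "cball (f x) e \<subseteq> O'"
      using f(2) x(2) open_contains_cball by blast
    then have "e / 2 > 0" by simp
    then obtain b where b: "b \<in> smooth_funs" "\<And>t. \<bar>t - f x\<bar> \<le> e / 2 \<Longrightarrow> b t = 1"
        "\<And>t. 2 * (e / 2) \<le> \<bar>t - f x\<bar> \<Longrightarrow> b t = 0"
      using smooth_bump[of "e / 2" "f x"] by metis
    have "Cr_into euclideanreal (\<lambda>y. b (f y))"
      unfolding Cr_into_def
      using Cr_on_real_compose[OF E smooth_funs_derivative b(1)]
        Cr_intoD[OF Cr_map_Cr_into[OF lc_space_euclideanreal f(1)]]
      by (auto simp del: Cr_into_def)
    moreover have "openin M {y \<in> topspace M. f y \<in> ball (f x) (e / 2)}"
      using openin_continuous_map_preimage[OF fc, of "ball (f x) (e / 2)"] by simp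
    moreover have "closedin M {y \<in> topspace M. f y \<in> cball (f x) e}"
      using closedin_continuous_map_preimage[OF fc, of "cball (f x) e"] by simp
    moreover have "x \<in> {y \<in> topspace M. f y \<in> ball (f x) (e / 2)}"
      using x e by simp
    moreover have "\<forall>y\<in>{y \<in> topspace M. f y \<in> ball (f x) (e / 2)}. b (f y) = 1"
      using b(2) by (auto simp: dist_real_def abs_minus_commute)
    moreover have "\<forall>y\<in>topspace M - {y \<in> topspace M. f y \<in> cball (f x) e}. b (f y) = 0"
      by (auto simp: dist_real_def abs_minus_commute intro!: b(3))
    moreover have "{y \<in> topspace M. f y \<in> cball (f x) e} \<subseteq> s"
      using e(2) f(3) by auto
    ultimately show ?case by blast
  qed simp
qed

end

section \<open>The embedding\<close>

locale Cr_mfd_cutoffs = Cr_mfd r M E A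
  for r and M :: "'m topology" and E :: "'e::real_vector topology" and A +
  fixes U :: "'m \<Rightarrow> 'm set" and \<phi> :: "'m \<Rightarrow> 'm \<Rightarrow> 'e"
    and h :: "'m \<Rightarrow> 'm \<Rightarrow> real" and N C :: "'m \<Rightarrow> 'm set"
  assumes U: "\<And>x. x \<in> topspace M \<Longrightarrow> (U x, \<phi> x) \<in> A"
    and h: "\<And>x. x \<in> topspace M \<Longrightarrow> Cr_into euclideanreal (h x)"
    and N: "\<And>x. x \<in> topspace M \<Longrightarrow> openin M (N x) \<and> x \<in> N x"
    and h1: "\<And>x y. x \<in> topspace M \<Longrightarrow> y \<in> N x \<Longrightarrow> h x y = 1"
    and C: "\<And>x. x \<in> topspace M \<Longrightarrow> closedin M (C x) \<and> C x \<subseteq> U x"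
    and h0: "\<And>x y. x \<in> topspace M \<Longrightarrow> y \<in> topspace M \<Longrightarrow> y \<notin> C x \<Longrightarrow> h x y = 0"
begin

abbreviation "F \<equiv> prod_topology E euclideanreal"
abbreviation "P \<equiv> lc_power F (topspace M)"

definition coord :: "'m \<Rightarrow> 'm \<Rightarrow> 'e \<times> real" where
  "coord x y = (if y \<in> U x then (h x y *\<^sub>R \<phi> x y, h x y) else 0)"

definition \<theta> :: "'m \<Rightarrow> 'm \<Rightarrow> 'e \<times> real" where
  "\<theta> y x = (if x \<in> topspace M then coord x y else 0)"

lemma F: "lc_space F"
  by (rule lc_space_prod[OF E lc_space_euclideanreal])

lemma P: "lc_space P"
  by (rule lc_space_power[OF F])

text \<open>Where the cutoff is 1 it is not 0, so \<open>N x\<close> lies in \<open>C x\<close>,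
  hence in \<open>U x\<close>.\<close>

lemma N_subset: "x \<in> topspace M \<Longrightarrow> N x \<subseteq> U x"
  using h0[of x] h1[of x] C[of x] openin_subset[of M "N x"] N[of x] by force

text \<open>The open sets \<open>V \<inter> U x\<close> and \<open>V - C x\<close> cover
  \<open>V\<close>, as \<open>C x \<subseteq> U x\<close>. The defining formula applies on the one;
  on the other the map is 0, including at points of \<open>U x\<close>, where both entries carry the
  factor \<open>h x\<close>.\<close>

lemma coord_Cr:
  assumes x: "x \<in> topspace M"
  shows "Cr_into F (coord x)"
  unfolding Cr_into_def
proof clarify
  fix V \<psi> assume V: "(V, \<psi>) \<in> A"
  let ?g = "inv_into V \<psi>"
  note V_open = chart_openin[OF V]
  show "Cr_on r E F (\<psi> ` V) (\<lambda>v. coord x (?g v))"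
  proof (rule Cr_on_local[OF E F chart_image_openin[OF V V_open order_refl]])
    fix v assume "v \<in> \<psi> ` V"
    then obtain y where y: "y \<in> V" "v = \<psi> y" by blast
    show "\<exists>O'. openin E O' \<and> v \<in> O' \<and> O' \<subseteq> \<psi> ` V \<and> Cr_on r E F O' (\<lambda>v. coord x (?g v))"
    proof (cases "y \<in> U x")
      case True
      let ?O = "\<psi> ` (V \<inter> U x)"
      have O_open: "openin E ?O"
        using V_open chart_openin[OF U[OF x]] by (intro chart_image_openin[OF V]) auto
      have \<phi>: "Cr_on r E E ?O (\<lambda>v. \<phi> x (?g v))"
        using chart_transition[OF V U[OF x]] by (simp add: o_def)
      have hg: "Cr_on r E euclideanreal ?O (\<lambda>v. h x (?g v))"
        by (rule Cr_on_subset[OF E lc_space_euclideanreal Cr_intoD[OF h[OF x] V] O_open]) auto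
      have "Cr_on r E F ?O (\<lambda>v. (h x (?g v) *\<^sub>R \<phi> x (?g v), h x (?g v)))"
        by (rule Cr_on_pair[OF E E lc_space_euclideanreal Cr_on_scaleR[OF E E hg \<phi>] hg])
      then have "Cr_on r E F ?O (\<lambda>v. coord x (?g v))"
        by (rule Cr_on_cong[OF E F, rotated]) (auto simp: coord_def chart_inv[OF V])
      then show ?thesis
        using O_open y True by blast
    next
      case False
      let ?O = "\<psi> ` (V - C x)"
      have O_open: "openin E ?O"
        using V_open C[OF x] by (intro chart_image_openin[OF V] openin_diff) auto
      have "Cr_on r E F ?O (\<lambda>v. 0)"
        by (rule Cr_on_const[OF E F O_open lc_zero[OF F]])
      moreover have "0 = coord x (?g v)" if "v \<in> ?O" for v
        using that h0[OF x] openin_subset[OF V_open]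
        by (auto simp: coord_def chart_inv[OF V] zero_prod_def)
      ultimately have "Cr_on r E F ?O (\<lambda>v. coord x (?g v))"
        using Cr_on_cong[OF E F, of ?O "\<lambda>v. 0" "\<lambda>v. coord x (?g v)"] by blast
      moreover have "v \<in> ?O"
        using y False C[OF x] by blast
      ultimately show ?thesis
        using O_open by blast
    qed
  qed
qed

lemma \<theta>_Cr: "Cr_into P \<theta>"
  unfolding Cr_into_def
proof clarify
  fix V \<psi> assume V: "(V, \<psi>) \<in> A"
  show "Cr_on r E P (\<psi> ` V) (\<lambda>v. \<theta> (inv_into V \<psi> v))"
    by (rule Cr_on_power[OF E F chart_image_openin[OF V chart_openin[OF V] order_refl]])
      (auto simp: \<theta>_def Cr_intoD[OF coord_Cr V])
qed

lemma \<theta>_continuous: "continuous_map M P \<theta>"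
  by (rule Cr_into_continuous[OF P \<theta>_Cr])

lemma \<theta>_separates:
  assumes W: "openin M W" "x \<in> W"
  shows "\<exists>Q. openin P Q \<and> \<theta> x \<in> Q \<and> (\<forall>y\<in>topspace M. \<theta> y \<in> Q \<longrightarrow> y \<in> W)"
proof -
  have x: "x \<in> topspace M"
    using W openin_subset by blast
  define O' where "O' = \<phi> x ` (W \<inter> U x)"
  have O_open: "openin E O'"
    unfolding O'_def using W chart_openin[OF U[OF x]] by (intro chart_image_openin[OF U[OF x]]) auto
  \<comment> \<open>The quotient that recovers the chart is continuous only where the real entry is
    nonzero; \<open>R\<close> is open in the whole power, so openness relative to \<open>R\<close>
    is openness in \<open>P\<close>.\<close>
  define R where "R = {p \<in> topspace P. snd (p x) \<noteq> 0}"
  have px: "continuous_map P F (\<lambda>p. p x)"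
    by (rule continuous_map_lc_power_component[OF F])
  have fx: "continuous_map P E (\<lambda>p. fst (p x))" and sx: "continuous_map P euclideanreal (\<lambda>p. snd (p x))"
    by (rule continuous_map_fst_comp[OF px], rule continuous_map_snd_comp[OF px])
  have R_open: "openin P R"
    unfolding R_def using openin_continuous_map_preimage[OF sx, of "- {0}"] by (simp add: open_Compl)
  have quot: "continuous_map (subtopology P R) E (\<lambda>p. inverse (snd (p x)) *\<^sub>R fst (p x))"
    using fx sx by (intro lc_continuous_scaleR[OF E] continuous_map_real_inverse continuous_map_from_subtopology)
      (auto simp: R_def)
  define Q where "Q = {p \<in> topspace (subtopology P R). inverse (snd (p x)) *\<^sub>R fst (p x) \<in> O'}"
  have "openin (subtopology P R) Q"
    unfolding Q_def by (rule openin_continuous_map_preimage[OF quot O_open])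
  then have "openin P Q"
    using R_open by (simp add: openin_open_subtopology)
  moreover have \<theta>_in: "\<theta> y \<in> topspace P" if "y \<in> topspace M" for y
    using continuous_map_image_subset_topspace[OF \<theta>_continuous] that by auto
  have "x \<in> U x" "h x x = 1"
    using N[OF x] N_subset[OF x] h1[OF x] by auto
  then have "\<theta> x \<in> Q"
    using \<theta>_in[OF x] x W by (auto simp: Q_def R_def \<theta>_def coord_def O'_def)
  moreover have "y \<in> W" if y: "y \<in> topspace M" "\<theta> y \<in> Q" for y
  proof -
    have "snd (coord x y) \<noteq> 0" and O_y: "inverse (snd (coord x y)) *\<^sub>R fst (coord x y) \<in> O'"
      using y(2) x by (auto simp: Q_def R_def \<theta>_def)
    \<comment> \<open>A nonzero real entry excludes the extension by 0, so \<open>y\<close> lies in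
      the domain of \<open>\<phi> x\<close>; injectivity there finally gives y \<in>
      \<open>W\<close>.\<close>
    then have yU: "y \<in> U x" and "h x y \<noteq> 0"
      by (auto simp: coord_def split: if_splits)
    then have "\<phi> x y \<in> O'"
      using O_y by (simp add: coord_def)
    then obtain z where "z \<in> W" "z \<in> U x" "\<phi> x y = \<phi> x z"
      by (auto simp: O'_def)
    with yU show ?thesis
      using inj_onD[OF chart_inj[OF U[OF x]]] by metis
  qed
  ultimately show ?thesis by blast
qed

text \<open>Injectivity separates x from the complement of {y}, which is open since points are
  closed in \<open>M\<close>. The image of an open \<open>W\<close> is the trace on the range of a
  union of the separating sets \<open>Q\<close>, so \<theta> is open onto its image.\<close>

lemma \<theta>_embedding: "embedding_map M P \<theta>"
proof -
  have inj: "inj_on \<theta> (topspace M)"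
  proof (rule inj_onI, rule ccontr)
    fix x y assume xy: "x \<in> topspace M" "y \<in> topspace M" "\<theta> x = \<theta> y" "x \<noteq> y"
    have "openin M (topspace M - {y})"
      using M xy(2) by (simp add: openin_diff closedin_Hausdorff_singleton)
    from \<theta>_separates[OF this, of x] xy show False by auto
  qed
  have "open_map M (subtopology P (\<theta> ` topspace M)) \<theta>"
    unfolding open_map_def
  proof (intro allI impI)
    fix W assume W: "openin M W"
    then obtain Q where Q: "\<And>x. x \<in> W \<Longrightarrow> openin P (Q x) \<and> \<theta> x \<in> Q x \<and> (\<forall>y\<in>topspace M. \<theta> y \<in> Q x \<longrightarrow> y \<in> W)"
      using \<theta>_separates by metis
    have "\<theta> ` W = (\<Union>x\<in>W. Q x) \<inter> \<theta> ` topspace M"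
      using Q openin_subset[OF W] by blast
    moreover have "openin P (\<Union>x\<in>W. Q x)"
      using Q by blast
    ultimately show "openin (subtopology P (\<theta> ` topspace M)) (\<theta> ` W)"
      unfolding openin_subtopology by blast
  qed
  moreover have "\<theta> ` topspace M \<subseteq> topspace P"
    using continuous_map_image_subset_topspace[OF \<theta>_continuous] by auto
  ultimately show ?thesis
    using inj \<theta>_continuous unfolding embedding_map_def
    by (intro bijective_open_imp_homeomorphic_map)
      (auto simp: continuous_map_in_subtopology Int_absorb1)
qed

lemma \<theta>_immersion: "Cr_immersion r M E A P P (lc_atlas r P) \<theta>"
  unfolding Cr_immersion_def
proof (intro conjI ballI)
  show "Cr_map r M E A P P (lc_atlas r P) \<theta>"
    by (rule Cr_into_Cr_map[OF P \<theta>_Cr])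
  fix x assume x: "x \<in> topspace M"
  define \<pi> where "\<pi> p = fst (p x)" for p :: "'m \<Rightarrow> 'e \<times> real"
  define j where "j v z = (if z = x then (v, 0::real) else 0)" for v :: 'e and z :: 'm
  define g where "g = inv_into (N x) (\<phi> x)"
  define O' where "O' = \<phi> x ` N x"
  \<comment> \<open>\<tau> collects all of \<theta> except the linear entry. On \<open>O'\<close> it
    is (0, 1) at index \<open>x\<close>, and at any other index it is the coordinate there,
    expressed in the chart around \<open>x\<close>.\<close>
  define \<tau> where "\<tau> v = \<theta> (g v) - j v" for v
  note z = lc_zero[OF F]
  have \<pi>: "linear_between P E \<pi>" "continuous_map P E \<pi>"
    unfolding \<pi>_def
    using x continuous_map_fst_comp[OF continuous_map_lc_power_component[OF F]]
    by (auto simp: linear_between_def topspace_lc_power[OF z] scaleR_fun_def)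
  have "continuous_map E F (\<lambda>v. j v i)" for i
    using lc_zero[OF E] z by (cases "i = x") (auto simp: j_def intro!: continuous_map_pairedI)
  then have j_cont: "continuous_map E P j"
    using x by (auto simp: continuous_map_lc_power[OF z] j_def)
  have j: "linear_between E P j"
    using continuous_map_image_subset_topspace[OF j_cont]
    by (auto simp: linear_between_def j_def fun_eq_iff scaleR_fun_def)
  have \<pi>j: "\<pi> (j v) = v" for v
    by (simp add: \<pi>_def j_def)
  have NA: "(N x, \<phi> x) \<in> A"
    using chart_restrict[OF U[OF x] _ N_subset[OF x]] N[OF x] by blast
  have O_open: "openin E O'"
    unfolding O'_def using N[OF x] by (intro chart_image_openin[OF NA]) auto
  have g: "g v \<in> N x" "\<phi> x (g v) = v" if "v \<in> O'" for v
    using that unfolding g_def O'_def by (auto simp: inv_into_into f_inv_into_f)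
  have \<pi>\<theta>: "\<pi> (\<theta> y) = \<phi> x y" if "y \<in> N x" for y
    using that x h1[OF x that] N_subset[OF x] by (auto simp: \<pi>_def \<theta>_def coord_def)
  have \<theta>_in: "\<theta> y \<in> topspace P" if "y \<in> N x" for y
    using continuous_map_image_subset_topspace[OF \<theta>_continuous] openin_subset[of M "N x"] N[OF x] that
    by blast
  have "Cr_on r E P O' \<tau>"
    unfolding \<tau>_def O'_def g_def
    by (rule Cr_on_diff[OF E P Cr_intoD[OF \<theta>_Cr NA] Cr_on_linear[OF E P j j_cont O_open[unfolded O'_def]]])
  moreover have "\<pi> (\<tau> v) = 0" if "v \<in> O'" for v
    using \<pi>\<theta>[OF g(1)[OF that]] g(2)[OF that] by (simp add: \<tau>_def \<pi>_def j_def)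
  ultimately have chart: "({p \<in> topspace P. \<pi> p \<in> O'}, \<lambda>p. p - \<tau> (\<pi> p)) \<in> lc_atlas r P"
    by (rule shear_chart[OF P E \<pi>])
  \<comment> \<open>At \<open>p = \<theta> (g v)\<close> the projection \<pi> returns
    \<open>v\<close>, so the shear subtracts exactly \<open>\<theta> (g v) - j v\<close>.\<close>
  have rep: "((\<lambda>p. p - \<tau> (\<pi> p)) \<circ> \<theta> \<circ> inv_into (N x) (\<phi> x)) v = j v" if "v \<in> \<phi> x ` N x" for v
  proof -
    have v: "v \<in> O'"
      using that by (simp add: O'_def)
    have "\<pi> (\<theta> (g v)) = v"
      using \<pi>\<theta>[OF g(1)[OF v]] g(2)[OF v] by simp
    then show ?thesis
      by (simp add: \<tau>_def flip: g_def)
  qed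
  have image: "\<theta> ` N x \<subseteq> {p \<in> topspace P. \<pi> p \<in> O'}"
    using \<pi>\<theta> \<theta>_in by (auto simp: O'_def)
  show "\<exists>(U, \<phi>)\<in>A. \<exists>(V, \<psi>)\<in>lc_atlas r P. x \<in> U \<and> \<theta> x \<in> V \<and> \<theta> ` U \<subseteq> V \<and>
      (\<exists>j. linear_between E P j \<and> embedding_map E P j \<and> complemented_subspace P (j ` topspace E) \<and>
        (\<forall>v\<in>\<phi> ` U. (\<psi> \<circ> \<theta> \<circ> inv_into U \<phi>) v = j v))"
  proof (rule bexI[OF _ NA], unfold prod.case, rule bexI[OF _ chart], unfold prod.case, intro conjI exI)
    show "x \<in> N x"
      using N[OF x] by blast
    then show "\<theta> x \<in> {p \<in> topspace P. \<pi> p \<in> O'}"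
      using image by blast
    show "\<theta> ` N x \<subseteq> {p \<in> topspace P. \<pi> p \<in> O'}"
      by (rule image)
    show "linear_between E P j"
      by (rule j)
    show "embedding_map E P j" "complemented_subspace P (j ` topspace E)"
      by (rule retract_complemented[OF P E \<pi> j j_cont], rule \<pi>j)+
    show "\<forall>v\<in>\<phi> x ` N x. ((\<lambda>p. p - \<tau> (\<pi> p)) \<circ> \<theta> \<circ> inv_into (N x) (\<phi> x)) v = j v"
      using rep by blast
  qed
qed

end

theorem theoremJ:
  fixes r :: enat
    and M :: "'m topology"
    and E :: "'e::real_vector topology"
    and A :: "('m, 'e) chart set"
  assumes "1 \<le> r"
    and "Cr_manifold r M E A"
    and "Cr_regular r M E A"
  defines "P \<equiv> lc_power (prod_topology E euclideanreal) (topspace M)"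
  shows "\<exists>\<theta> :: 'm \<Rightarrow> 'm \<Rightarrow> 'e \<times> real. Cr_embedding r M E A P P (lc_atlas r P) \<theta>"
proof -
  interpret Cr_mfd r M E A
    by unfold_locales fact
  \<comment> \<open>The whole chart domain plays the role of the open set in
    \<open>cutoff_exists\<close>. The data are then chosen for all points simultaneously, one
    component of the power for each.\<close>
  have "\<exists>U \<phi> h N C. (U, \<phi>) \<in> A \<and> Cr_into euclideanreal h \<and> openin M N \<and> x \<in> N \<and> (\<forall>y\<in>N. h y = 1) \<and>
      closedin M C \<and> C \<subseteq> U \<and> (\<forall>y\<in>topspace M - C. h y = 0)" if x: "x \<in> topspace M" for x
  proof -
    obtain U \<phi> where U: "(U, \<phi>) \<in> A" "x \<in> U"
      using x by (rule chart_at)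
    show ?thesis
      using cutoff_exists[OF assms(3) chart_openin[OF U(1)] U(2)] U(1) by blast
  qed
  then obtain U \<phi> h N C where *: "\<And>x. x \<in> topspace M \<Longrightarrow> (U x, \<phi> x) \<in> A \<and> Cr_into euclideanreal (h x) \<and>
      openin M (N x) \<and> x \<in> N x \<and> (\<forall>y\<in>N x. h x y = 1) \<and>
      closedin M (C x) \<and> C x \<subseteq> U x \<and> (\<forall>y\<in>topspace M - C x. h x y = 0)"
    by metis
  interpret Cr_mfd_cutoffs r M E A U \<phi> h N C
    by unfold_locales (use * in blast)+
  show ?thesis
    unfolding P_def Cr_embedding_def using \<theta>_immersion \<theta>_embedding by blast
qed

end
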